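(* Fix $t_0\in(0,1)$ and suppose that there exists $z\in\mathbb{C}$ such that $z\notin\operatorname{Spec}(\mathcal{N}_t+V_t)$ for all $t$ near $t_0$. Suppose that $\zeta_0\notin\operatorname{Spec}(\mathcal{N}_{t_0}+V_{t_0})$ and define, for $\varepsilon>0$, $$\mathcal{U}_\varepsilon:=\{(t,\zeta)\in(0,1)\times\mathbb{C}:|t-t_0|\le\varepsilon,\ |\zeta-\zeta_0|\le\varepsilon\}.$$ 1. Suppose that the mappings $t\mapsto V_t$, $t\mapsto\mathrm{T}_t$, $t\mapsto Q_t$, $t\mapsto P_t$ are continuous at $t_0$. Then there exists $\varepsilon>0$ such that if $(t,\zeta)\in\mathcal{U}_\varepsilon$ then $\zeta\notin\operatorname{Spec}(\mathcal{N}_t+V_t)$, and the operator valued function $t\mapsto R_t(\zeta)=(\mathcal{N}_t+V_t-\zeta)^{-1}\in\mathcal{B}(\mathcal{H}^2)$ is continuous at $t_0$ uniformly for $|\zeta-\zeta_0|<\varepsilon$. 2. Suppose that the mappings $t\mapsto V_t$, $t\mapsto\mathrm{T}_t$, $t\mapsto Q_t$, $t\mapsto P_t$ are Lipschitz continuous at $t_0$. Then there exist $\varepsilon>0$ as in part 1 and a constant $c>0$ such that for all $(t,\zeta)\in\mathcal{U}_\varepsilon$ $$\|R_t(\zeta)-R_{t_0}(\zeta)\|_{\mathcal{B}(\mathcal{H}^2)}\le c|t-t_0|.$$ 3. Suppose that the mappings $t\mapsto V_t$, $t\mapsto\mathrm{T}_t$, $t\mapsto Q_t$, $t\mapsto P_t$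 are differentiable at $t_0$. Then for some $\varepsilon>0$ the following asymptotic expansion holds in $\mathcal{B}(\mathcal{H}^2)$ as $t\to t_0$, uniformly for $|\zeta-\zeta_0|<\varepsilon$: $$R_t(\zeta)=R_{t_0}(\zeta)+\Big(-R_{t_0}(\zeta)\dot V_{t_0}R_{t_0}(\zeta)+\tau\big(\mathrm{T}_{t_0}R_{t_0}(\bar\zeta)\big)^*\big(\dot P_{t_0}J\oplus(-\dot Q_{t_0}J)\big)\mathrm{T}_{t_0}R_{t_0}(\zeta)+\tau\big(\mathrm{T}_{t_0}R_{t_0}(\bar\zeta)\big)^*\mathcal{J}\,\dot{\mathrm{T}}_{t_0}R_{t_0}(\zeta)\Big)(t-t_0)+o(t-t_0).$$
   Context: $\mathcal{H},\mathfrak{H}$ are separable complex Hilbert spaces. $A$ is a closed, densely defined, symmetric linear operator in $\mathcal{H}$ with $\dim\ker(A^*+i)=\dim\ker(A^*-i)<\infty$. $\mathcal{H}_+:=\operatorname{dom}(A^* )$ carries the graph scalar product of $A^*$. Put $\mathcal{H}^2=\mathcal{H}\times\mathcal{H}$, $\mathcal{H}_+^2=\mathcal{H}_+\times\mathcal{H}_+$, $\mathfrak{H}^2=\mathfrak{H}\times\mathfrak{H}$, $\mathfrak{H}^4=\mathfrak{H}^2\times\mathfrak{H}^2$, and $$\tau=\begin{pmatrix}0&I_{\mathcal{H}}\\ I_{\mathcal{H}}&0\end{pmatrix}\ \text{on }\mathcal{H}^2,\qquad J=\begin{pmatrix}0&I_{\mathfrak{H}}\\ -I_{\mathfrak{H}}&0\end{pmatrix}\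 \text{on }\mathfrak{H}^2,\qquad \mathcal{J}=J\oplus(-J)\ \text{on }\mathfrak{H}^4,$$ where $X\oplus Y$ is the block diagonal operator on $\mathfrak{H}^4=\mathfrak{H}^2\times\mathfrak{H}^2$. A subspace of $\mathfrak{H}^2$ is Lagrangian if it equals its annihilator with respect to $\omega(f,g)=\langle Jf,g\rangle_{\mathfrak{H}^2}$. Standing assumptions on one-parameter families, $t\in[0,1]$: (a) $\operatorname{tr}_t=(\Gamma_{0,t},\Gamma_{1,t})^\top\in\mathcal{B}(\mathcal{H}_+,\mathfrak{H}^2)$ is surjective and satisfies $\langle A^*u,v\rangle_{\mathcal{H}}-\langle u,A^*v\rangle_{\mathcal{H}}=\langle\Gamma_{1,t}u,\Gamma_{0,t}v\rangle_{\mathfrak{H}}-\langle\Gamma_{0,t}u,\Gamma_{1,t}v\rangle_{\mathfrak{H}}$ for all $u,v\in\mathcal{H}_+$; $\mathrm{T}_t:=\operatorname{tr}_t\oplus\operatorname{tr}_t\in\mathcal{B}(\mathcal{H}_+^2,\mathfrak{H}^4)$. (b) $P_t,Q_t\in\mathcal{B}(\mathfrak{H}^2)$ are orthogonal projections with Lagrangian ranges. (c) $\mathcal{A}_t,\mathcal{B}_t$ are self-adjoint extensions of $A$ with $\operatorname{tr}_t(\operatorname{dom}\mathcal{A}_t)=\operatorname{ran}P_t$, $\operatorname{tr}_t(\operatorname{dom}\mathcal{B}_t)=\operatorname{ran}Q_t$, and $\mathcal{N}_t=\begin{pmatrix}0&-\mathcal{B}_t\\ \mathcal{A}_t&0\end{pmatrix}$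 with $\operatorname{dom}\mathcal{N}_t=\operatorname{dom}\mathcal{A}_t\times\operatorname{dom}\mathcal{B}_t$. (d) $F_t,G_t\in\mathcal{B}(\mathcal{H})$ are self-adjoint and $V_t=\begin{pmatrix}0&-G_t\\ F_t&0\end{pmatrix}\in\mathcal{B}(\mathcal{H}^2)$. Continuity, Lipschitz continuity at $t_0$ and differentiability of $V_t,\mathrm{T}_t,P_t,Q_t$ are in the operator norms of $\mathcal{B}(\mathcal{H}^2)$, $\mathcal{B}(\mathcal{H}_+^2,\mathfrak{H}^4)$, $\mathcal{B}(\mathfrak{H}^2)$, $\mathcal{B}(\mathfrak{H}^2)$ respectively; the dot denotes $d/dt$. $\mathrm{T}_{t_0}R_{t_0}(\zeta)$ is regarded as an element of $\mathcal{B}(\mathcal{H}^2,\mathfrak{H}^4)$ and $(\cdot)^*$ is its adjoint. *)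

theory Defs
  imports "HOL-Analysis.Analysis"
begin

section \<open>Complex Hilbert spaces\<close>

text \<open>
  The scalar product is linear in its first argument. A complex inner product space is a real inner
  product space (with the real part as real scalar product), so norm, topology and completeness are
  those of the real library classes.
\<close>

class complex_vector = real_vector +
  fixes scaleC :: "complex \<Rightarrow> 'a \<Rightarrow> 'a"  (infixr "*\<^sub>C" 75)
  assumes scaleC_add_right: "a *\<^sub>C (x + y) = a *\<^sub>C x + a *\<^sub>C y"
    and scaleC_add_left: "(a + b) *\<^sub>C x = a *\<^sub>C x + b *\<^sub>C x"
    and scaleC_scaleC: "a *\<^sub>C (b *\<^sub>C x) = (a * b) *\<^sub>C x"
    and scaleC_one: "1 *\<^sub>C x = x"
    and scaleR_scaleC: "r *\<^sub>R x = complex_of_real r *\<^sub>C x"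

interpretation complex_vector: vector_space "scaleC :: complex \<Rightarrow> 'a \<Rightarrow> 'a::complex_vector"
  by unfold_locales (simp_all add: scaleC_add_right scaleC_add_left scaleC_scaleC scaleC_one)

class complex_inner = complex_vector + real_inner +
  fixes cinner :: "'a \<Rightarrow> 'a \<Rightarrow> complex"
  assumes cinner_commute: "cinner x y = cnj (cinner y x)"
    and cinner_add_left: "cinner (x + y) z = cinner x z + cinner y z"
    and cinner_scaleC_left: "cinner (a *\<^sub>C x) y = a * cinner x y"
    and inner_cinner: "inner x y = Re (cinner x y)"

class chilbert_space = complex_inner + complete_space

instantiation complex :: chilbert_space
begin
definition scaleC_complex :: "complex \<Rightarrow> complex \<Rightarrow> complex" where "scaleC_complex a x = a * x"
definition cinner_complex :: "complex \<Rightarrow> complex \<Rightarrow> complex" where "cinner_complex x y = x * cnj y"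
instance
  by standard
    (simp_all add: scaleC_complex_def cinner_complex_def inner_complex_def scaleR_conv_of_real
      algebra_simps)
end

instantiation prod :: (complex_vector, complex_vector) complex_vector
begin
definition scaleC_prod :: "complex \<Rightarrow> 'a \<times> 'b \<Rightarrow> 'a \<times> 'b"
  where "scaleC_prod a x = (a *\<^sub>C fst x, a *\<^sub>C snd x)"
instance
  by standard
    (simp_all add: scaleC_prod_def prod_eq_iff scaleC_add_right scaleC_add_left scaleC_scaleC
      scaleC_one scaleR_scaleC)
end

instantiation prod :: (complex_inner, complex_inner) complex_inner
begin
definition cinner_prod :: "'a \<times> 'b \<Rightarrow> 'a \<times> 'b \<Rightarrow> complex"
  where "cinner_prod x y = cinner (fst x) (fst y) + cinner (snd x) (snd y)"
instance
proof
  fix x y z :: "'a \<times> 'b" and a :: complex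
  show "cinner x y = cnj (cinner y x)"
    by (metis cinner_prod_def cinner_commute complex_cnj_add)
qed (simp_all add: cinner_prod_def scaleC_prod_def cinner_add_left cinner_scaleC_left
      inner_prod_def inner_cinner algebra_simps)
end

instance prod :: (chilbert_space, chilbert_space) chilbert_space ..

text \<open>
  A bounded operator between complex spaces is a complex linear element of the library type
  \<^typ>\<open>'a \<Rightarrow>\<^sub>L 'b\<close> of bounded real linear maps, whose norm is the operator norm.
\<close>

abbreviation clinear :: "('a::complex_vector \<Rightarrow> 'b::complex_vector) \<Rightarrow> bool"
  where "clinear \<equiv> Vector_Spaces.linear scaleC scaleC"

definition cbounded :: "('a::complex_inner \<Rightarrow>\<^sub>L 'b::complex_inner) set"
  where "cbounded = {X. clinear (blinfun_apply X)}"

text \<open>For complex linear \<open>X\<close> between Hilbert spaces, the operator below exists and is unique.\<close>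

definition cadjoint :: "('a::chilbert_space \<Rightarrow>\<^sub>L 'b::chilbert_space) \<Rightarrow> ('b \<Rightarrow>\<^sub>L 'a)"
  where "cadjoint X = (THE Y :: 'b \<Rightarrow>\<^sub>L 'a. \<forall>x y. cinner (X x) y = cinner x (Y y))"

definition bounded_selfadjoint :: "('a::complex_inner \<Rightarrow>\<^sub>L 'a) \<Rightarrow> bool"
  where "bounded_selfadjoint X \<longleftrightarrow> X \<in> cbounded \<and> (\<forall>x y. cinner (X x) y = cinner x (X y))"

definition orthogonal_projection :: "('a::complex_inner \<Rightarrow>\<^sub>L 'a) \<Rightarrow> bool"
  where "orthogonal_projection X \<longleftrightarrow> bounded_selfadjoint X \<and> X o\<^sub>L X = X"


section \<open>Block operators on products\<close>

lift_definition block_diag ::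
  "('a::real_normed_vector \<Rightarrow>\<^sub>L 'c::real_normed_vector) \<Rightarrow>
   ('b::real_normed_vector \<Rightarrow>\<^sub>L 'd::real_normed_vector) \<Rightarrow> ('a \<times> 'b) \<Rightarrow>\<^sub>L ('c \<times> 'd)"
  is "\<lambda>X Y. \<lambda>(u, v). (X u, Y v)"
  unfolding case_prod_unfold
  by (intro bounded_linear_Pair) (auto intro: bounded_linear_compose bounded_linear_fst bounded_linear_snd)

text \<open>\<open>block_offdiag X Y\<close> is the matrix with upper right entry \<open>X\<close>, lower left entry \<open>Y\<close>.\<close>

lift_definition block_offdiag ::
  "('b::real_normed_vector \<Rightarrow>\<^sub>L 'c::real_normed_vector) \<Rightarrow>
   ('a::real_normed_vector \<Rightarrow>\<^sub>L 'd::real_normed_vector) \<Rightarrow> ('a \<times> 'b) \<Rightarrow>\<^sub>L ('c \<times> 'd)"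
  is "\<lambda>X Y. \<lambda>(u, v). (X v, Y u)"
  unfolding case_prod_unfold
  by (intro bounded_linear_Pair) (auto intro: bounded_linear_compose bounded_linear_fst bounded_linear_snd)

definition op_tau :: "('h::complex_inner \<times> 'h) \<Rightarrow>\<^sub>L ('h \<times> 'h)"
  where "op_tau = block_offdiag id_blinfun id_blinfun"

definition op_J :: "('k::complex_inner \<times> 'k) \<Rightarrow>\<^sub>L ('k \<times> 'k)"
  where "op_J = block_offdiag id_blinfun (- id_blinfun)"

definition op_JJ :: "(('k::complex_inner \<times> 'k) \<times> ('k \<times> 'k)) \<Rightarrow>\<^sub>L (('k \<times> 'k) \<times> ('k \<times> 'k))"
  where "op_JJ = block_diag op_J (- op_J)"

definition lagrangian :: "('k::complex_inner \<times> 'k) set \<Rightarrow> bool"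
  where "lagrangian L \<longleftrightarrow>
    complex_vector.subspace L \<and> L = {g. \<forall>f\<in>L. cinner (op_J f) g = 0}"


section \<open>Unbounded operators\<close>

text \<open>
  An operator with domain is represented by its graph: \<open>(u, w) \<in> G\<close> means that \<open>u\<close> is in the
  domain and is mapped to \<open>w\<close>. The domain is \<^term>\<open>Domain G\<close>, extension is inclusion
  of graphs, and an operator is closed iff its graph is a closed set.
\<close>

definition linear_operator :: "('a::complex_vector \<times> 'b::complex_vector) set \<Rightarrow> bool"
  where "linear_operator G \<longleftrightarrow> complex_vector.subspace G \<and> single_valued G"

definition op_apply :: "('a \<times> 'b) set \<Rightarrow> 'a \<Rightarrow> 'b"
  where "op_apply G u = (THE w. (u, w) \<in> G)"

definition op_ker :: "('a \<times> 'b::zero) set \<Rightarrow> 'a set"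
  where "op_ker G = {u. (u, 0) \<in> G}"

definition densely_defined :: "('a::topological_space \<times> 'b) set \<Rightarrow> bool"
  where "densely_defined G \<longleftrightarrow> closure (Domain G) = UNIV"

text \<open>The graph of the adjoint; it is single valued if \<open>G\<close> is densely defined.\<close>

definition op_adjoint :: "('a::complex_inner \<times> 'b::complex_inner) set \<Rightarrow> ('b \<times> 'a) set"
  where "op_adjoint G = {(v, w). \<forall>(u, u')\<in>G. cinner u' v = cinner u w}"

definition symmetric_op :: "('a::complex_inner \<times> 'a) set \<Rightarrow> bool"
  where "symmetric_op G \<longleftrightarrow> (\<forall>(u, u')\<in>G. \<forall>(v, v')\<in>G. cinner u' v = cinner u v')"

definition selfadjoint_op :: "('a::complex_inner \<times> 'a) set \<Rightarrow> bool"
  where "selfadjoint_op G \<longleftrightarrow> linear_operator G \<and> densely_defined G \<and> op_adjoint G = G"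

definition op_add_bounded ::
  "('a::real_normed_vector \<times> 'b::real_normed_vector) set \<Rightarrow> ('a \<Rightarrow>\<^sub>L 'b) \<Rightarrow> ('a \<times> 'b) set"
  where "op_add_bounded G X = {(u, w + X u) | u w. (u, w) \<in> G}"

definition op_shift :: "('a::complex_vector \<times> 'a) set \<Rightarrow> complex \<Rightarrow> ('a \<times> 'a) set"
  where "op_shift G z = {(u, w - z *\<^sub>C u) | u w. (u, w) \<in> G}"

text \<open>\<open>op_offdiag B A\<close> is the analogue of \<^const>\<open>block_offdiag\<close>, with domain
  \<open>Domain A \<times> Domain B\<close>.\<close>

definition op_offdiag ::
  "('b \<times> 'c) set \<Rightarrow> ('a \<times> 'd) set \<Rightarrow> (('a \<times> 'b) \<times> ('c \<times> 'd)) set"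
  where "op_offdiag B A = {((u, v), (b, a)) | u v a b. (u, a) \<in> A \<and> (v, b) \<in> B}"

definition op_uminus :: "('a \<times> 'b::uminus) set \<Rightarrow> ('a \<times> 'b) set"
  where "op_uminus G = {(u, - w) | u w. (u, w) \<in> G}"

text \<open>\<open>is_resolvent G z R\<close>: the inverse relation of \<open>G - z\<close> is an everywhere defined bounded
  operator, namely \<open>R\<close>.\<close>

definition is_resolvent :: "('a::complex_inner \<times> 'a) set \<Rightarrow> complex \<Rightarrow> ('a \<Rightarrow>\<^sub>L 'a) \<Rightarrow> bool"
  where "is_resolvent G z R \<longleftrightarrow> R \<in> cbounded \<and> (op_shift G z)\<inverse> = {(f, R f) | f. True}"

definition spectrum :: "('a::complex_inner \<times> 'a) set \<Rightarrow> complex set"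
  where "spectrum G = {z. \<not> (\<exists>R. is_resolvent G z R)}"

definition resolvent :: "('a::complex_inner \<times> 'a) set \<Rightarrow> complex \<Rightarrow> 'a \<Rightarrow>\<^sub>L 'a"
  where "resolvent G z = (THE R. is_resolvent G z R)"

lemma is_resolvent_unique: "is_resolvent G z R \<Longrightarrow> is_resolvent G z S \<Longrightarrow> R = S"
  unfolding is_resolvent_def by (rule blinfun_eqI) blast

lemma is_resolvent_resolvent: "z \<notin> spectrum G \<Longrightarrow> is_resolvent G z (resolvent G z)"
  unfolding resolvent_def spectrum_def by (rule theI') (auto dest: is_resolvent_unique)

definition finite_dim :: "'a::complex_vector set \<Rightarrow> bool"
  where "finite_dim S \<longleftrightarrow> (\<exists>B. finite B \<and> S \<subseteq> complex_vector.span B)"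


section \<open>Bounded operators on a subspace with its own norm\<close>

text \<open>
  The space \<open>dom A*\<close> carries the graph norm, which is not the norm of its type. Operators on it
  are therefore functions on the ambient type, considered only on a carrier \<open>S\<close> normed by \<open>n\<close>.
\<close>

text \<open>The norm of the graph scalar product: the square root of
  \<open>(norm u)\<^sup>2 + (norm (op_apply G u))\<^sup>2\<close>.\<close>

definition graph_norm :: "('a::real_normed_vector \<times> 'b::real_normed_vector) set \<Rightarrow> 'a \<Rightarrow> real"
  where "graph_norm G u = norm (u, op_apply G u)"

text \<open>The Hilbert norm on the product of a space normed by \<open>n\<close> with itself.\<close>

definition pair_norm :: "('a \<Rightarrow> real) \<Rightarrow> 'a \<times> 'a \<Rightarrow> real"
  where "pair_norm n p = norm (n (fst p), n (snd p))"

definition bounded_on ::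
  "'a::complex_vector set \<Rightarrow> ('a \<Rightarrow> real) \<Rightarrow> ('a \<Rightarrow> 'b::complex_inner) \<Rightarrow> bool"
  where "bounded_on S n f \<longleftrightarrow>
    (\<forall>x\<in>S. \<forall>y\<in>S. f (x + y) = f x + f y) \<and> (\<forall>c. \<forall>x\<in>S. f (c *\<^sub>C x) = c *\<^sub>C f x) \<and>
    (\<exists>K. \<forall>x\<in>S. norm (f x) \<le> K * n x)"

definition onorm_on :: "'a set \<Rightarrow> ('a \<Rightarrow> real) \<Rightarrow> ('a \<Rightarrow> 'b::real_normed_vector) \<Rightarrow> real"
  where "onorm_on S n f = (SUP x\<in>S. norm (f x) / n x)"

definition op_continuous_at ::
  "'a set \<Rightarrow> ('a \<Rightarrow> real) \<Rightarrow> (real \<Rightarrow> 'a \<Rightarrow> 'b::real_normed_vector) \<Rightarrow> real \<Rightarrow> bool"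
  where "op_continuous_at S n T t0 \<longleftrightarrow>
    ((\<lambda>t. onorm_on S n (\<lambda>x. T t x - T t0 x)) \<longlongrightarrow> 0) (at t0)"

definition op_lipschitz_at ::
  "'a set \<Rightarrow> ('a \<Rightarrow> real) \<Rightarrow> (real \<Rightarrow> 'a \<Rightarrow> 'b::real_normed_vector) \<Rightarrow> real \<Rightarrow> bool"
  where "op_lipschitz_at S n T t0 \<longleftrightarrow>
    (\<exists>L. \<forall>\<^sub>F t in at t0. onorm_on S n (\<lambda>x. T t x - T t0 x) \<le> L * \<bar>t - t0\<bar>)"

definition op_has_derivative_at ::
  "'a::complex_vector set \<Rightarrow> ('a \<Rightarrow> real) \<Rightarrow> (real \<Rightarrow> 'a \<Rightarrow> 'b::complex_inner) \<Rightarrow> ('a \<Rightarrow> 'b) \<Rightarrow> real \<Rightarrow> bool"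
  where "op_has_derivative_at S n T T' t0 \<longleftrightarrow> bounded_on S n T' \<and>
    ((\<lambda>t. onorm_on S n (\<lambda>x. (T t x - T t0 x) /\<^sub>R (t - t0) - T' x)) \<longlongrightarrow> 0) (at t0)"

definition lipschitz_at :: "(real \<Rightarrow> 'b::real_normed_vector) \<Rightarrow> real \<Rightarrow> bool"
  where "lipschitz_at X t0 \<longleftrightarrow> (\<exists>L. \<forall>\<^sub>F t in at t0. norm (X t - X t0) \<le> L * \<bar>t - t0\<bar>)"

text \<open>\<open>f R\<close> as a bounded operator, where \<open>f\<close> is defined on a subspace containing the range of
  \<open>R\<close> (in the intended use \<open>R\<close> is bounded into the graph norm, so \<open>f R\<close> is indeed bounded).\<close>

definition comp_blinfun ::
  "('b::real_normed_vector \<Rightarrow> 'c::real_normed_vector) \<Rightarrow> ('a::real_normed_vector \<Rightarrow>\<^sub>L 'b) \<Rightarrow> 'a \<Rightarrow>\<^sub>L 'c"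
  where "comp_blinfun f R = Blinfun (\<lambda>x. f (R x))"

end

theory Submission
  imports Defs
begin

text \<open>
  Write \<open>M_t = N_t + V_t\<close> and \<open>R_t(\<zeta>)\<close> for its resolvent, \<open>P_t \<oplus> Q_t\<close> for the boundary projection, and
  \<open>L\<close> for the maximal operator with entries \<open>- A\<^sup>*\<close>, \<open>A\<^sup>*\<close> off the diagonal. Only the boundary
  condition and \<open>V_t\<close> distinguish the \<open>M_t\<close>: each is a restriction of \<open>L\<close> plus a bounded operator, and
  it is self-adjoint for the indefinite scalar product \<open>\<langle>u, \<tau> v\<rangle>\<close>. Hence
  \<open>R_t(\<zeta>)\<^sup>* = \<tau> R_t(\<zeta>\<^sup>*) \<tau>\<close>, and Green's formula compares two of the operators on the
  boundary. The result is the exact Krein formula (lemma \<open>krein_identity\<close>), with \<open>J\<close> standing for the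
  boundary form \<open>J \<oplus> (- J)\<close> and \<open>P_t\<close> for \<open>P_t \<oplus> Q_t\<close>,

    \<open>\<langle>(R_t - R_s) f, \<tau> g\<rangle> = \<langle>((P_t - P_s) J T_t + J (T_t - T_s)) R_t f, T_s y\<rangle> - \<langle>(V_t - V_s) R_t f, \<tau> y\<rangle>\<close>

  where \<open>y = R_s(\<zeta>\<^sup>*) g\<close> and the resolvents on the left are taken at \<open>\<zeta>\<close>. Each term on the right
  contains a difference of the data. The equation \<open>L R_t f = f - V_t R_t f + \<zeta> R_t f\<close> bounds
  \<open>R_t\<close> as a map into the graph norm, in which the traces are bounded. So the formula yields
  \<open>\<parallel>R_t - R_s\<parallel> \<le> C d (1 + \<parallel>R_t\<parallel>)\<close> when the data differ by \<open>d\<close>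
  (lemma \<open>norm_resolvent_diff_le\<close>); for small \<open>d\<close> the last factor is absorbed.

  This estimate presupposes that \<open>R_t(\<zeta>)\<close> exists. It exists at the common resolvent point \<open>z\<close>, so that
  \<open>R_t(z)\<close> converges in norm to its value at \<open>t0\<close>, and \<open>\<zeta>\<close> is a resolvent point of \<open>M_t\<close> if and only if
  the bounded operator \<open>1 - (\<zeta> - z) R_t(z)\<close> is invertible. Invertibility is an open condition in
  \<open>(t, \<zeta>)\<close>, with locally bounded inverse (lemma \<open>resolvent_set_stable\<close>). Continuity and the Lipschitz
  bound follow. For the expansion the differences of data in the Krein formula are replaced by
  their linearizations and \<open>R_t\<close> by \<open>R_s\<close>; by the first-order estimate the error is \<open>o(t - s)\<close>
  (lemma \<open>norm_resolvent_remainder_le\<close>).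

  The adjoint in the expansion requires the Riesz representation theorem, which is proved by
  minimizing a quadratic energy.
\<close>

section \<open>Complex scalar products\<close>

lemma cinner_add_right: "cinner x (y + z) = cinner x y + cinner x z"
  by (metis cinner_add_left cinner_commute complex_cnj_add)

lemma cinner_scaleC_right: "cinner x (a *\<^sub>C y) = cnj a * cinner x y"
  by (metis cinner_commute cinner_scaleC_left complex_cnj_mult)

lemma cinner_zero_left [simp]: "cinner 0 y = 0"
  using cinner_add_left[of 0 0 y] by simp

lemma cinner_zero_right [simp]: "cinner x 0 = 0"
  using cinner_add_right[of x 0 0] by simp

lemma cinner_minus_left: "cinner (- x) y = - cinner x y"
  using cinner_add_left[of x "- x" y] by (simp add: add_eq_0_iff)

lemma cinner_minus_right: "cinner x (- y) = - cinner x y"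
  using cinner_add_right[of x y "- y"] by (simp add: add_eq_0_iff)

lemma cinner_diff_left: "cinner (x - y) z = cinner x z - cinner y z"
  using cinner_add_left[of x "- y" z] by (simp add: cinner_minus_left)

lemma cinner_diff_right: "cinner x (y - z) = cinner x y - cinner x z"
  using cinner_add_right[of x y "- z"] by (simp add: cinner_minus_right)

lemmas cinner_algebra =
  cinner_add_left cinner_add_right cinner_diff_left cinner_diff_right
  cinner_minus_left cinner_minus_right cinner_scaleC_left cinner_scaleC_right

lemma cinner_cancel_right: "(\<And>x. cinner x y = cinner x z) \<Longrightarrow> y = z"
  by (metis cinner_diff_right diff_self inner_cinner inner_eq_zero_iff right_minus_eq zero_complex.sel(1))

lemma norm_scaleC: "norm (c *\<^sub>C x) = cmod c * norm x" for x :: "'a::complex_inner"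
proof -
  have real: "Im (cinner x x) = 0"
    using arg_cong[OF cinner_commute[of x x], of Im] by simp
  have "cinner (c *\<^sub>C x) (c *\<^sub>C x) = (c * cnj c) * cinner x x"
    by (simp add: cinner_scaleC_left cinner_scaleC_right)
  then have "Re (cinner (c *\<^sub>C x) (c *\<^sub>C x)) = (cmod c)\<^sup>2 * Re (cinner x x)"
    by (simp add: complex_norm_square[symmetric] real del: of_real_power)
  then have "(norm (c *\<^sub>C x))\<^sup>2 = (cmod c * norm x)\<^sup>2"
    by (simp add: power2_norm_eq_inner inner_cinner power_mult_distrib)
  then show ?thesis
    by (simp add: power2_eq_iff_nonneg)
qed

lemma cbounded_iff: "X \<in> cbounded \<longleftrightarrow> (\<forall>c x. X (c *\<^sub>C x) = c *\<^sub>C X x)"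
proof
  assume "X \<in> cbounded"
  then show "\<forall>c x. X (c *\<^sub>C x) = c *\<^sub>C X x"
    by (simp add: cbounded_def module_hom.scale[OF Vector_Spaces.linear.axioms(3)])
next
  assume "\<forall>c x. X (c *\<^sub>C x) = c *\<^sub>C X x"
  then show "X \<in> cbounded"
    unfolding cbounded_def
    by (auto intro!: Vector_Spaces.linear.intro module_hom.intro module_hom_axioms.intro
        complex_vector.vector_space_axioms complex_vector.module_axioms simp: blinfun.add_right)
qed

lemma norm_blinfun_le:
  assumes "norm X \<le> K" shows "norm (blinfun_apply X x) \<le> K * norm x"
  using norm_blinfun[of X x] assms by (meson mult_right_mono norm_ge_zero order_trans)


section \<open>The Riesz representation theorem and adjoints\<close>

lemma quadratic_minimum_at_zero:
  fixes a b :: real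
  assumes "\<And>t. 0 \<le> a * t + b * t\<^sup>2"
  shows "a = 0"
proof (rule ccontr)
  assume "a \<noteq> 0"
  \<comment> \<open>The minimizer after \<open>b\<close> has been enlarged to the positive number \<open>\<bar>b\<bar> + 1\<close>.\<close>
  define t where "t = - a / (2 * (\<bar>b\<bar> + 1))"
  have "a * t + b * t\<^sup>2 \<le> a * t + (\<bar>b\<bar> + 1) * t\<^sup>2"
    by (simp add: mult_right_mono)
  also have "\<dots> = - a\<^sup>2 / (4 * (\<bar>b\<bar> + 1))"
  proof -
    have "0 < c \<Longrightarrow> a * (- a / (2 * c)) + c * (- a / (2 * c))\<^sup>2 = - a\<^sup>2 / (4 * c)" for c :: real
      by (simp add: power2_eq_square field_simps)
    from this[of "\<bar>b\<bar> + 1"] show ?thesis unfolding t_def by simp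
  qed
  also have "\<dots> < 0"
    using \<open>a \<noteq> 0\<close> by (simp add: divide_neg_pos add_nonneg_pos)
  finally show False using assms[of t] by simp
qed

text \<open>The functional is represented by the minimizer of its energy
  \<open>\<parallel>x\<parallel>\<^sup>2 / 2 - \<phi> x\<close>. A minimizing sequence is Cauchy by the parallelogram law, and the
  Euler-Lagrange equation at the limit is the representation formula.\<close>

lemma riesz_real:
  fixes \<phi> :: "'a::{real_inner, complete_space} \<Rightarrow> real"
  assumes "bounded_linear \<phi>"
  shows "\<exists>h. \<forall>x. \<phi> x = inner x h"
proof -
  interpret bounded_linear \<phi> by fact
  obtain K where K: "\<And>x. \<bar>\<phi> x\<bar> \<le> norm x * K"
    using bounded by auto
  define E where "E x = (norm x)\<^sup>2 / 2 - \<phi> x" for x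
  have E_lower: "- K\<^sup>2 / 2 \<le> E x" for x
  proof -
    have "\<phi> x \<le> norm x * K" using K[of x] by linarith
    moreover have "0 \<le> (norm x - K)\<^sup>2" by simp
    ultimately show ?thesis by (simp add: E_def power2_diff)
  qed
  define m where "m = (INF x. E x)"
  have bdd: "bdd_below (range E)" using E_lower by (intro bdd_belowI[of _ "- K\<^sup>2 / 2"]) auto
  have m_le: "m \<le> E x" for x unfolding m_def by (rule cINF_lower[OF bdd]) simp
  have "\<exists>x. E x < m + inverse (real (Suc n))" for n
  proof -
    have "(INF x. E x) < m + inverse (real (Suc n))" by (simp add: m_def)
    then show ?thesis using cInf_lessD[of "range E"] by blast
  qed
  then obtain x where x: "\<And>n. E (x n) < m + inverse (real (Suc n))" by metis
  have parallelogram: "(norm (u - v))\<^sup>2 / 4 = E u + E v - 2 * E ((1/2) *\<^sub>R (u + v))" for u v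
    unfolding E_def power2_norm_eq_inner
    by (simp add: add scaleR inner_add_left inner_add_right inner_diff_left inner_diff_right
        inner_commute field_simps)
  have close: "(norm (x i - x j))\<^sup>2 \<le> 8 * inverse (real (Suc n))" if "n \<le> i" "n \<le> j" for i j n
  proof -
    have "inverse (real (Suc i)) \<le> inverse (real (Suc n))" "inverse (real (Suc j)) \<le> inverse (real (Suc n))"
      using that by auto
    then show ?thesis
      using parallelogram[of "x i" "x j"] x[of i] x[of j] m_le[of "(1/2) *\<^sub>R (x i + x j)"]
      by linarith
  qed
  have "Cauchy x"
  proof (rule metric_CauchyI)
    fix e :: real assume "0 < e"
    then obtain n where n: "inverse (real (Suc n)) < e\<^sup>2 / 8"
      using reals_Archimedean[of "e\<^sup>2 / 8"] by auto
    have "dist (x i) (x j) < e" if "n \<le> i" "n \<le> j" for i j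
    proof -
      have "(norm (x i - x j))\<^sup>2 < e\<^sup>2" using close[OF that] n by linarith
      then show ?thesis using \<open>0 < e\<close> by (simp add: dist_norm power_less_imp_less_base)
    qed
    then show "\<exists>M. \<forall>i\<ge>M. \<forall>j\<ge>M. dist (x i) (x j) < e" by blast
  qed
  then obtain h where h: "x \<longlonglongrightarrow> h" using Cauchy_convergent convergent_def by blast
  have "(\<lambda>n. E (x n)) \<longlonglongrightarrow> E h"
    unfolding E_def by (intro tendsto_intros tendsto h) auto
  moreover have "(\<lambda>n. m + inverse (real (Suc n))) \<longlonglongrightarrow> m + 0"
    by (intro tendsto_intros LIMSEQ_inverse_real_of_nat)
  ultimately have "E h \<le> m + 0"
    by (rule LIMSEQ_le) (use x less_imp_le in blast)
  then have E_h: "E h \<le> E y" for y using m_le[of y] by linarith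
  have "\<phi> y = inner y h" for y
  proof -
    have "0 \<le> (inner y h - \<phi> y) * t + ((norm y)\<^sup>2 / 2) * t\<^sup>2" for t
      using E_h[of "h + t *\<^sub>R y"] unfolding E_def power2_norm_eq_inner
      by (simp add: add scaleR inner_add_left inner_add_right inner_commute algebra_simps
          power2_eq_square)
    then have "inner y h - \<phi> y = 0" by (rule quadratic_minimum_at_zero)
    then show ?thesis by simp
  qed
  then show ?thesis by blast
qed

lemma norm_adjoint_vector_le:
  assumes "\<And>x. cinner (blinfun_apply X x) u = cinner x v"
  shows "norm v \<le> norm X * norm u"
proof (cases "v = 0")
  case False
  have "norm v * norm v = inner (X v) u"
    by (simp add: inner_cinner assms flip: power2_eq_square) (simp add: power2_norm_eq_inner inner_cinner)
  also have "\<dots> \<le> norm (X v) * norm u" by (rule norm_cauchy_schwarz)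
  also have "\<dots> \<le> (norm X * norm v) * norm u"
    by (intro mult_right_mono norm_blinfun) auto
  finally show ?thesis using False by (simp add: mult.commute mult.left_commute)
qed simp

lemma cadjoint_works:
  fixes X :: "'a::chilbert_space \<Rightarrow>\<^sub>L 'b::chilbert_space"
  assumes X: "X \<in> cbounded"
  shows "cinner (X x) y = cinner x (cadjoint X y)"
proof -
  have "\<exists>h. \<forall>x. cinner (X x) y = cinner x h" for y
  proof -
    have "bounded_linear (\<lambda>x. inner (X x) y)"
      by (intro bounded_linear_compose[OF bounded_linear_inner_left] blinfun.bounded_linear_right)
    then obtain h where h: "\<And>x. inner (X x) y = inner x h" using riesz_real by blast
    have Re: "Re (cinner (X x) y) = Re (cinner x h)" for x
      using h by (simp add: inner_cinner)
    \<comment> \<open>The imaginary part of a complex linear functional is minus its real part at \<open>\<i> x\<close>.\<close>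
    have "Im (cinner (X x) y) = Im (cinner x h)" for x
      using Re[of "\<i> *\<^sub>C x"] X by (simp add: cbounded_iff cinner_scaleC_left)
    with Re show ?thesis by (auto intro!: exI[of _ h] complex_eqI)
  qed
  then obtain Y where Y: "\<And>x y. cinner (X x) y = cinner x (Y y)" by metis
  have "bounded_linear Y"
  proof
    show "Y (u + v) = Y u + Y v" for u v
      by (rule cinner_cancel_right) (simp add: Y[symmetric] cinner_add_right)
    show "Y (r *\<^sub>R u) = r *\<^sub>R Y u" for r u
      by (rule cinner_cancel_right)
        (simp add: Y[symmetric] scaleR_scaleC cinner_scaleC_right)
    have "norm (Y u) \<le> norm u * norm X" for u
      using norm_adjoint_vector_le[OF Y] by (simp add: mult.commute)
    then show "\<exists>K. \<forall>u. norm (Y u) \<le> norm u * K" by blast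
  qed
  then have ex: "\<forall>x y. cinner (X x) y = cinner x (Blinfun Y y)"
    using Y by (simp add: bounded_linear_Blinfun_apply)
  have "\<forall>x y. cinner (X x) y = cinner x (cadjoint X y)"
    unfolding cadjoint_def
  proof (rule theI[of _ "Blinfun Y"])
    fix Z :: "'b \<Rightarrow>\<^sub>L 'a" assume "\<forall>x y. cinner (X x) y = cinner x (Z y)"
    with ex have "cinner x (Z y) = cinner x (Blinfun Y y)" for x y by metis
    then show "Z = Blinfun Y" by (blast intro: blinfun_eqI cinner_cancel_right)
  qed (rule ex)
  then show ?thesis by blast
qed

lemma cadjoint_cbounded:
  assumes "X \<in> cbounded" shows "cadjoint X \<in> cbounded"
proof -
  have "cadjoint X (c *\<^sub>C y) = c *\<^sub>C cadjoint X y" for c y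
    by (rule cinner_cancel_right)
       (simp add: cadjoint_works[OF assms, symmetric] cinner_scaleC_right)
  then show ?thesis by (simp add: cbounded_iff)
qed

lemma norm_cadjoint_le:
  assumes "X \<in> cbounded" shows "norm (cadjoint X) \<le> norm X"
  by (rule norm_blinfun_bound[OF norm_ge_zero])
     (rule norm_adjoint_vector_le[OF cadjoint_works[OF assms]])


section \<open>Perturbation of inverses and resolvents\<close>

lift_definition scaleC_blinfun :: "complex \<Rightarrow> 'a::complex_inner \<Rightarrow>\<^sub>L 'a" is "scaleC"
proof -
  fix c
  show "bounded_linear ((*\<^sub>C) c :: 'a \<Rightarrow> 'a)"
    by (rule bounded_linear_intro[where K="cmod c"])
       (simp_all add: scaleC_add_right norm_scaleC scaleR_scaleC scaleC_scaleC mult.commute)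
qed

text \<open>The Neumann series is summed by the contraction principle: \<open>S f\<close> is the fixed point of
  \<open>x \<mapsto> f + X x\<close>.\<close>

lemma neumann_inverse:
  fixes X :: "'a::chilbert_space \<Rightarrow>\<^sub>L 'a"
  assumes X: "X \<in> cbounded" and small: "norm X \<le> 1 / 2"
  obtains S where "S \<in> cbounded" "\<And>x. S (x - X x) = x" "\<And>x. S x - X (S x) = x" "norm S \<le> 2"
proof -
  have half: "norm (X x) \<le> norm x / 2" for x
    using norm_blinfun_le[OF small, of x] by simp
  have "\<exists>!x. f + X x = x" for f
    proof (rule banach_fix_type[where c="1/2"])
      show "\<forall>x y. dist (f + X x) (f + X y) \<le> 1 / 2 * dist x y"
      proof (intro allI)
        fix x y show "dist (f + X x) (f + X y) \<le> 1 / 2 * dist x y"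
          using half[of "x - y"] by (simp add: dist_norm blinfun.diff_right)
      qed
    qed auto
  then obtain S where S: "\<And>f. f + X (S f) = S f" and uniq: "\<And>f x. f + X x = x \<Longrightarrow> x = S f"
    unfolding Ex1_def by metis
  have norm_S: "norm (S f) \<le> norm f * 2" for f
    using norm_triangle_ineq[of f "X (S f)"] half[of "S f"] by (simp add: S)
  have "bounded_linear S"
  proof
    show "S (f + g) = S f + S g" for f g
      using uniq[of "f + g" "S f + S g"] S[of f] S[of g]
      by (metis (no_types, lifting) add.assoc add.left_commute blinfun.add_right)
    show "S (r *\<^sub>R f) = r *\<^sub>R S f" for r f
      using uniq[of "r *\<^sub>R f" "r *\<^sub>R S f"] S[of f]
      by (simp add: blinfun.scaleR_right flip: scaleR_add_right)
    show "\<exists>K. \<forall>f. norm (S f) \<le> norm f * K" using norm_S by blast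
  qed
  then have B: "blinfun_apply (Blinfun S) = S" by (rule bounded_linear_Blinfun_apply)
  show thesis
  proof (rule that[of "Blinfun S"], unfold B)
    have "S (c *\<^sub>C f) = c *\<^sub>C S f" for c f
      using uniq[of "c *\<^sub>C f" "c *\<^sub>C S f"] S[of f] X
      by (simp add: cbounded_iff flip: scaleC_add_right)
    then show "Blinfun S \<in> cbounded" by (simp add: cbounded_iff B)
    show "S (x - X x) = x" for x using uniq[of "x - X x" x] by simp
    show "S x - X (S x) = x" for x using S[of x] by (simp add: algebra_simps)
    show "norm (Blinfun S) \<le> 2"
      by (rule norm_blinfun_bound) (use norm_S in \<open>auto simp: B mult.commute\<close>)
  qed
qed

text \<open>\<open>Z = X (1 - Y (X - Z))\<close>, and the second factor has a Neumann inverse. The explicit bound on the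
  inverse of \<open>Z\<close> is what makes the later estimates uniform.\<close>

lemma perturbed_inverse:
  fixes X Y Z :: "'a::chilbert_space \<Rightarrow>\<^sub>L 'a"
  assumes "X \<in> cbounded" "Y \<in> cbounded" "Z \<in> cbounded"
    and YX: "\<And>x. Y (X x) = x" and XY: "\<And>x. X (Y x) = x"
    and small: "norm Y * norm (Z - X) \<le> 1 / 2"
  obtains W where "W \<in> cbounded" "\<And>x. W (Z x) = x" "\<And>x. Z (W x) = x" "norm W \<le> 2 * norm Y"
proof -
  let ?E = "Y o\<^sub>L (X - Z)"
  have "norm ?E \<le> 1 / 2"
    using norm_blinfun_compose[of Y "X - Z"] small by (simp add: norm_minus_commute)
  moreover have "?E \<in> cbounded"
    using assms(1-3) by (simp add: cbounded_iff blinfun.diff_left blinfun.diff_right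
        complex_vector.scale_right_diff_distrib)
  ultimately obtain S where S: "S \<in> cbounded" "\<And>x. S (x - ?E x) = x" "\<And>x. S x - ?E (S x) = x"
    "norm S \<le> 2" using neumann_inverse by blast
  have E: "x - ?E x = Y (Z x)" for x
    by (simp add: blinfun.diff_left blinfun.diff_right YX)
  show thesis
  proof (rule that[of "S o\<^sub>L Y"])
    show "(S o\<^sub>L Y) (Z x) = x" for x using S(2)[of x] unfolding E by simp
    have "Y (Z (S (Y x))) = Y x" for x using S(3)[of "Y x"] unfolding E .
    then show "Z ((S o\<^sub>L Y) x) = x" for x by (metis XY blinfun_apply_blinfun_compose)
    show "S o\<^sub>L Y \<in> cbounded" using S(1) assms(2) by (simp add: cbounded_iff)
    show "norm (S o\<^sub>L Y) \<le> 2 * norm Y"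
      using norm_blinfun_compose[of S Y] S(4) by (meson mult_right_mono norm_ge_zero order_trans)
  qed
qed

lemma is_resolvent_iff:
  "is_resolvent G z R \<longleftrightarrow> R \<in> cbounded \<and> (\<forall>(u, w)\<in>G. R (w - z *\<^sub>C u) = u) \<and>
     (\<forall>f. (R f, f + z *\<^sub>C R f) \<in> G)"
proof -
  have "(op_shift G z)\<inverse> = {(f, R f) | f. True} \<longleftrightarrow>
      (\<forall>(u, w)\<in>G. R (w - z *\<^sub>C u) = u) \<and> (\<forall>f. (R f, f + z *\<^sub>C R f) \<in> G)" (is "?l \<longleftrightarrow> ?r")
  proof
    assume eq: ?l
    have "R (w - z *\<^sub>C u) = u" if "(u, w) \<in> G" for u w
    proof -
      have "(w - z *\<^sub>C u, u) \<in> (op_shift G z)\<inverse>" using that by (auto simp: op_shift_def)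
      then show ?thesis unfolding eq by auto
    qed
    moreover have "(R f, f + z *\<^sub>C R f) \<in> G" for f
    proof -
      have "(f, R f) \<in> (op_shift G z)\<inverse>" unfolding eq by auto
      then show ?thesis by (auto simp: op_shift_def eq_diff_eq)
    qed
    ultimately show ?r by auto
  next
    assume r: ?r
    show ?l
    proof (intro set_eqI iffI)
      fix p assume "p \<in> (op_shift G z)\<inverse>"
      then show "p \<in> {(f, R f) | f. True}" using r by (auto simp: op_shift_def)
    next
      fix p assume "p \<in> {(f, R f) | f. True}"
      then obtain f where p: "p = (f, R f)" by auto
      have "(R f, (f + z *\<^sub>C R f) - z *\<^sub>C R f) \<in> op_shift G z"
        using r unfolding op_shift_def by blast
      then show "p \<in> (op_shift G z)\<inverse>" by (simp add: p)
    qed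
  qed
  then show ?thesis by (simp add: is_resolvent_def)
qed

lemma resolvent_eqI: "is_resolvent G z R \<Longrightarrow> resolvent G z = R"
  unfolding resolvent_def by (blast intro: is_resolvent_unique)

lemma not_in_spectrumI: "is_resolvent G z R \<Longrightarrow> z \<notin> spectrum G"
  by (auto simp: spectrum_def)

text \<open>Invertibility of \<open>G - \<zeta>\<close> is reduced to that of a bounded operator: formally
  \<open>G - \<zeta> = (1 - (\<zeta> - z) R(z)) (G - z)\<close>. If \<open>z\<close> is a resolvent point, then \<open>\<zeta>\<close> is one as soon as
  \<open>1 - (\<zeta> - z) R(z)\<close> is invertible.
  Conversely the inverse is \<open>1 + (\<zeta> - z) R(\<zeta>)\<close>, which is the resolvent identity.\<close>

definition shift_factor :: "complex \<Rightarrow> ('a::complex_inner \<Rightarrow>\<^sub>L 'a) \<Rightarrow> 'a \<Rightarrow>\<^sub>L 'a"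
  where "shift_factor c R = id_blinfun - (scaleC_blinfun c o\<^sub>L R)"

lemma shift_factor_apply: "shift_factor c R x = x - c *\<^sub>C R x"
  by (simp add: shift_factor_def blinfun.diff_left scaleC_blinfun.rep_eq)

lemma shift_factor_cbounded: "R \<in> cbounded \<Longrightarrow> shift_factor c R \<in> cbounded"
  by (simp add: cbounded_iff shift_factor_apply complex_vector.scale_right_diff_distrib
      complex_vector.scale_left_commute)

lemma norm_shift_factor_diff:
  "norm (shift_factor c R - shift_factor c' R') \<le> cmod c * norm (R - R') + cmod (c - c') * norm R'"
proof (rule norm_blinfun_bound)
  fix x
  have "(shift_factor c R - shift_factor c' R') x = - (c *\<^sub>C (R - R') x) - (c - c') *\<^sub>C R' x"
    by (simp add: shift_factor_apply blinfun.diff_left complex_vector.scale_right_diff_distrib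
        complex_vector.scale_left_diff_distrib)
  also have "norm \<dots> \<le> norm (c *\<^sub>C (R - R') x) + norm ((c - c') *\<^sub>C R' x)"
    using norm_triangle_ineq4[of "- (c *\<^sub>C (R - R') x)"] by simp
  also have "\<dots> \<le> cmod c * (norm (R - R') * norm x) + cmod (c - c') * (norm R' * norm x)"
    unfolding norm_scaleC by (intro add_mono mult_left_mono norm_blinfun) auto
  finally show "norm ((shift_factor c R - shift_factor c' R') x) \<le>
      (cmod c * norm (R - R') + cmod (c - c') * norm R') * norm x"
    by (simp add: algebra_simps)
qed auto

lemma is_resolvent_via_shift_factor:
  assumes R: "is_resolvent G z R" and W: "W \<in> cbounded"
    "\<And>x. W (shift_factor (\<zeta> - z) R x) = x" "\<And>x. shift_factor (\<zeta> - z) R (W x) = x"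
  shows "is_resolvent G \<zeta> (R o\<^sub>L W)"
proof -
  have Rc: "R \<in> cbounded" and R1: "\<And>u w. (u, w) \<in> G \<Longrightarrow> R (w - z *\<^sub>C u) = u"
    and R2: "\<And>f. (R f, f + z *\<^sub>C R f) \<in> G" using R by (auto simp: is_resolvent_iff)
  have "R (W (w - \<zeta> *\<^sub>C u)) = u" if "(u, w) \<in> G" for u w
  proof -
    have "w - \<zeta> *\<^sub>C u = shift_factor (\<zeta> - z) R (w - z *\<^sub>C u)"
      by (simp add: shift_factor_apply R1[OF that] complex_vector.scale_left_diff_distrib)
    then show ?thesis by (simp add: W R1[OF that])
  qed
  moreover have "(R (W f), f + \<zeta> *\<^sub>C R (W f)) \<in> G" for f
  proof -
    have "f + \<zeta> *\<^sub>C R (W f) = W f + z *\<^sub>C R (W f)"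
      using W(3)[of f] by (simp add: shift_factor_apply complex_vector.scale_left_diff_distrib
          algebra_simps)
    then show ?thesis using R2[of "W f"] by simp
  qed
  ultimately show ?thesis using Rc W(1) by (auto simp: is_resolvent_iff cbounded_iff)
qed

lemma shift_factor_inverse:
  assumes R: "is_resolvent G z R" and S: "is_resolvent G \<zeta> S"
  shows "shift_factor (z - \<zeta>) S (shift_factor (\<zeta> - z) R x) = x"
proof -
  have "(R x, x + z *\<^sub>C R x) \<in> G" using R by (simp add: is_resolvent_iff)
  then have "S (x + z *\<^sub>C R x - \<zeta> *\<^sub>C R x) = R x" using S unfolding is_resolvent_iff by blast
  then have "S (shift_factor (\<zeta> - z) R x) = R x"
    by (simp add: shift_factor_apply complex_vector.scale_left_diff_distrib algebra_simps)
  then show ?thesis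
    by (simp add: shift_factor_apply[of "z - \<zeta>"])
      (simp add: shift_factor_apply complex_vector.scale_left_diff_distrib)
qed


section \<open>Extensions of a symmetric operator with boundary conditions\<close>

lemma bounded_on_diff:
  assumes "complex_vector.subspace S" "bounded_on S n f" "u \<in> S" "v \<in> S"
  shows "f (u - v) = f u - f v"
proof -
  have "f (u - v + v) = f (u - v) + f v"
    using assms complex_vector.subspace_diff[OF assms(1,3,4)] unfolding bounded_on_def by blast
  then show ?thesis by simp
qed

lemma bounded_on_obtain_bound:
  assumes "bounded_on S n f" "\<And>x. x \<in> S \<Longrightarrow> 0 \<le> n x"
  obtains K where "0 \<le> K" "\<And>x. x \<in> S \<Longrightarrow> norm (f x) \<le> K * n x"
proof -
  obtain K where K: "\<And>x. x \<in> S \<Longrightarrow> norm (f x) \<le> K * n x"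
    using assms(1) unfolding bounded_on_def by blast
  show thesis
  proof (rule that[of "max K 0"])
    show "norm (f x) \<le> max K 0 * n x" if "x \<in> S" for x
      using K[OF that] mult_right_mono[OF max.cobounded1[of K 0] assms(2)[OF that]] by linarith
  qed simp
qed

text \<open>The common data of all extensions, in the coordinates in which the block structure is invisible:
  \<open>L\<close> is the maximal operator, here with domain \<open>D = dom A\<^sup>* \<times> dom A\<^sup>*\<close> and entries \<open>- A\<^sup>*\<close>,
  \<open>A\<^sup>*\<close> off the diagonal, \<open>gnorm\<close> is its graph norm, and \<open>J\<close> will be the boundary form
  \<open>J \<oplus> (- J)\<close>. The operators of interest are not self-adjoint, but they become so for the
  indefinite scalar product \<open>\<langle>u, \<tau> v\<rangle>\<close>.\<close>

locale boundary_space =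
  fixes D :: "'x::chilbert_space set"
    and L :: "'x \<Rightarrow> 'x"
    and \<tau> :: "'x \<Rightarrow>\<^sub>L 'x"
    and J :: "'y::chilbert_space \<Rightarrow>\<^sub>L 'y"
    and gnorm :: "'x \<Rightarrow> real"
  assumes gnorm_def: "gnorm = (\<lambda>w. norm (w, L w))"
    and subspace_D: "complex_vector.subspace D"
    and L_linear: "bounded_on D gnorm L"
    and \<tau>_cbounded: "\<tau> \<in> cbounded"
    and \<tau>_\<tau> [simp]: "\<tau> (\<tau> x) = x"
    and \<tau>_symmetric: "cinner (\<tau> x) y = cinner x (\<tau> y)"
    and norm_J_le: "norm (J k) \<le> norm k"
begin

lemma \<tau>_scaleC: "\<tau> (c *\<^sub>C x) = c *\<^sub>C \<tau> x"
  using \<tau>_cbounded by (simp add: cbounded_iff)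

lemma norm_\<tau> [simp]: "norm (\<tau> x) = norm x"
  by (simp add: norm_eq_sqrt_inner inner_cinner \<tau>_symmetric)

lemma gnorm_nonneg: "0 \<le> gnorm w"
  by (simp add: gnorm_def)

lemma norm_le_gnorm: "norm w \<le> gnorm w"
  using norm_fst_le[of w "L w"] by (simp add: gnorm_def)

lemma gnorm_le: "gnorm w \<le> norm w + norm (L w)"
  by (simp add: gnorm_def norm_Pair_le)

lemma D_diff: "u \<in> D \<Longrightarrow> v \<in> D \<Longrightarrow> u - v \<in> D"
  by (rule complex_vector.subspace_diff[OF subspace_D])

lemma comp_blinfun_apply:
  fixes R :: "'z::real_normed_vector \<Rightarrow>\<^sub>L 'x"
  assumes f: "bounded_on D gnorm f" and R: "\<And>x. R x \<in> D" "\<And>x. gnorm (R x) \<le> K * norm x"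
  shows "blinfun_apply (comp_blinfun f R) x = f (R x)"
proof -
  obtain C where C: "0 \<le> C" "\<And>x. x \<in> D \<Longrightarrow> norm (f x) \<le> C * gnorm x"
    using bounded_on_obtain_bound[OF f gnorm_nonneg] by blast
  have "bounded_linear (\<lambda>x. f (R x))"
  proof (rule bounded_linear_intro[where K="C * K"])
    show "f (R (x + y)) = f (R x) + f (R y)" for x y
      using f R(1) by (simp add: bounded_on_def blinfun.add_right)
    show "f (R (r *\<^sub>R x)) = r *\<^sub>R f (R x)" for r x
      using f R(1) by (simp add: bounded_on_def blinfun.scaleR_right scaleR_scaleC)
    show "norm (f (R x)) \<le> norm x * (C * K)" for x
      using C(2)[OF R(1)[of x]] mult_left_mono[OF R(2)[of x] C(1)] by (simp add: ac_simps)
  qed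
  then show ?thesis
    by (simp add: comp_blinfun_def bounded_linear_Blinfun_apply)
qed

end

text \<open>A single operator \<open>N + V\<close>: \<open>N\<close> is a restriction of the maximal operator \<open>L\<close> by a boundary
  condition and is self-adjoint for the twisted scalar product \<open>\<langle>u, \<tau> v\<rangle>\<close>, and \<open>V\<close> is symmetric
  for it. If \<open>P\<close> is a projection, the condition on \<open>P\<close> and \<open>J\<close> says that \<open>J\<close> exchanges its range with
  the orthogonal complement, which is how a Lagrangian range enters the estimates.\<close>

locale extension = boundary_space D L \<tau> J gnorm
  for D :: "'x::chilbert_space set" and L \<tau> and J :: "'y::chilbert_space \<Rightarrow>\<^sub>L 'y" and gnorm +
  fixes T :: "'x \<Rightarrow> 'y" and P :: "'y \<Rightarrow>\<^sub>L 'y" and N :: "('x \<times> 'x) set" and V :: "'x \<Rightarrow>\<^sub>L 'x"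
  assumes T_bounded: "bounded_on D gnorm T"
    and green: "u \<in> D \<Longrightarrow> v \<in> D \<Longrightarrow>
      cinner (L u) (\<tau> v) - cinner u (\<tau> (L v)) = cinner (J (T u)) (T v)"
    and P_symmetric: "cinner (P k) l = cinner k (P l)"
    and P_J: "P (J k) = J k - J (P k)"
    and N_subset: "(u, w) \<in> N \<Longrightarrow> u \<in> D \<and> w = L u \<and> P (T u) = T u"
    and N_selfadjoint: "(v, v') \<in> N \<longleftrightarrow> (\<forall>(u, u')\<in>N. cinner u' (\<tau> v) = cinner u (\<tau> v'))"
    and V_symmetric: "cinner (V u) (\<tau> v) = cinner u (\<tau> (V v))"
begin

abbreviation "H \<equiv> op_add_bounded N V"

lemma resolvent_in_N:
  assumes "is_resolvent H \<zeta> R"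
  shows "(R f, f - V (R f) + \<zeta> *\<^sub>C R f) \<in> N"
proof -
  have "(R f, f + \<zeta> *\<^sub>C R f) \<in> H" using assms by (simp add: is_resolvent_iff)
  then obtain w where "(R f, w) \<in> N" "f + \<zeta> *\<^sub>C R f = w + V (R f)"
    by (auto simp: op_add_bounded_def)
  moreover from this have "w = f - V (R f) + \<zeta> *\<^sub>C R f" by (simp add: algebra_simps)
  ultimately show ?thesis by simp
qed

lemmas resolvent_in_D = resolvent_in_N[THEN N_subset, THEN conjunct1]
  and L_resolvent = resolvent_in_N[THEN N_subset, THEN conjunct2, THEN conjunct1, symmetric]
  and P_T_resolvent = resolvent_in_N[THEN N_subset, THEN conjunct2, THEN conjunct2]

lemma resolvent_left_inverse:
  assumes "is_resolvent H \<zeta> R" "(u, w) \<in> N"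
  shows "R (w + V u - \<zeta> *\<^sub>C u) = u"
proof -
  have "(u, w + V u) \<in> H" using assms(2) by (auto simp: op_add_bounded_def)
  then show ?thesis using assms(1) unfolding is_resolvent_iff by blast
qed

text \<open>The equation \<open>L R f = f - V R f + \<zeta> R f\<close> bounds the graph norm of \<open>R f\<close>.\<close>

lemma gnorm_resolvent_le:
  assumes "is_resolvent H \<zeta> R"
  shows "gnorm (R f) \<le> (norm V + cmod \<zeta> + 1) * (1 + norm R) * norm f"
proof -
  have "norm (L (R f)) \<le> norm (f - V (R f)) + norm (\<zeta> *\<^sub>C R f)"
    unfolding L_resolvent[OF assms] by (rule norm_triangle_ineq)
  also have "norm (f - V (R f)) \<le> norm f + norm (V (R f))" by (rule norm_triangle_ineq4)
  finally have "gnorm (R f) \<le> norm f + (norm (R f) + norm (V (R f)) + cmod \<zeta> * norm (R f))"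
    using gnorm_le[of "R f"] by (simp add: norm_scaleC)
  also have "\<dots> \<le> norm f + (norm V + cmod \<zeta> + 1) * norm (R f)"
    using norm_blinfun[of V "R f"] by (simp add: algebra_simps)
  also have "\<dots> \<le> (norm V + cmod \<zeta> + 1) * norm f + (norm V + cmod \<zeta> + 1) * (norm R * norm f)"
    by (intro add_mono mult_left_mono norm_blinfun) (auto simp: algebra_simps)
  finally show ?thesis by (simp add: algebra_simps)
qed

lemma comp_resolvent_apply:
  assumes "bounded_on D gnorm f" "is_resolvent H \<zeta> R"
  shows "blinfun_apply (comp_blinfun f R) x = f (R x)"
  using comp_blinfun_apply[OF assms(1) resolvent_in_D[OF assms(2)] gnorm_resolvent_le[OF assms(2)]] .

lemma comp_resolvent_cbounded:
  assumes "bounded_on D gnorm f" "is_resolvent H \<zeta> R"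
  shows "comp_blinfun f R \<in> cbounded"
  using assms(1) resolvent_in_D[OF assms(2)] assms(2)
  by (simp add: cbounded_iff comp_resolvent_apply[OF assms] bounded_on_def is_resolvent_iff)

text \<open>Self-adjointness for the twisted scalar product makes the spectrum symmetric about the real
  axis: \<open>R(\<zeta>\<^sup>*) = \<tau> R(\<zeta>)\<^sup>* \<tau>\<close>.\<close>

lemma resolvent_cnj:
  assumes R: "is_resolvent H \<zeta> R"
  obtains S where "is_resolvent H (cnj \<zeta>) S" "norm S \<le> norm R"
proof -
  have Rc: "R \<in> cbounded" using R by (simp add: is_resolvent_iff)
  define S where "S = \<tau> o\<^sub>L cadjoint R o\<^sub>L \<tau>"
  have S: "cinner f (\<tau> (S g)) = cinner (R f) (\<tau> g)" for f g
    by (simp add: S_def cadjoint_works[OF Rc])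
  have left: "S (v' + V v - cnj \<zeta> *\<^sub>C v) = v" if v: "(v, v') \<in> N" for v v'
  proof -
    have "cinner f (\<tau> (S (v' + V v - cnj \<zeta> *\<^sub>C v))) = cinner f (\<tau> v)" for f
    proof -
      have "cinner (f - V (R f) + \<zeta> *\<^sub>C R f) (\<tau> v) = cinner (R f) (\<tau> v')"
        using N_selfadjoint v resolvent_in_N[OF R, of f] by blast
      then show ?thesis
        unfolding S by (simp add: blinfun.add_right blinfun.diff_right \<tau>_scaleC cinner_algebra
            V_symmetric algebra_simps)
    qed
    then have "\<tau> (S (v' + V v - cnj \<zeta> *\<^sub>C v)) = \<tau> v" by (rule cinner_cancel_right)
    then show ?thesis by (metis \<tau>_\<tau>)
  qed
  have right: "(S g, g - V (S g) + cnj \<zeta> *\<^sub>C S g) \<in> N" for g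
  proof -
    have "cinner w' (\<tau> (S g)) = cinner w (\<tau> (g - V (S g) + cnj \<zeta> *\<^sub>C S g))" if "(w, w') \<in> N" for w w'
    proof -
      have "cinner (w' + V w - \<zeta> *\<^sub>C w) (\<tau> (S g)) = cinner w (\<tau> g)"
        unfolding S resolvent_left_inverse[OF R that] ..
      then show ?thesis
        by (simp add: blinfun.add_right blinfun.diff_right \<tau>_scaleC cinner_algebra
            V_symmetric algebra_simps)
    qed
    then show ?thesis by (subst N_selfadjoint) blast
  qed
  show thesis
  proof (rule that)
    have "S \<in> cbounded"
      using cadjoint_cbounded[OF Rc] \<tau>_cbounded by (simp add: S_def cbounded_iff)
    moreover have "(S g, g + cnj \<zeta> *\<^sub>C S g) \<in> H" for g
    proof -
      have "g + cnj \<zeta> *\<^sub>C S g = (g - V (S g) + cnj \<zeta> *\<^sub>C S g) + V (S g)" by simp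
      then show ?thesis using right[of g] unfolding op_add_bounded_def by blast
    qed
    ultimately show "is_resolvent H (cnj \<zeta>) S"
      using left by (auto simp: is_resolvent_iff op_add_bounded_def)
    show "norm S \<le> norm R"
    proof (rule norm_blinfun_bound)
      show "norm (S g) \<le> norm R * norm g" for g
        using norm_blinfun_le[OF norm_cadjoint_le[OF Rc], of "\<tau> g"] by (simp add: S_def)
    qed simp
  qed
qed

text \<open>The relation \<open>R(\<zeta>)\<^sup>* \<tau> = \<tau> R(\<zeta>\<^sup>*)\<close> in weak form.\<close>

lemma resolvent_pairing:
  assumes R: "is_resolvent H \<zeta> R" and S: "is_resolvent H (cnj \<zeta>) S"
  shows "cinner (R f) (\<tau> g) = cinner f (\<tau> (S g))"
proof -
  have "cinner (f - V (R f) + \<zeta> *\<^sub>C R f) (\<tau> (S g)) =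
      cinner (R f) (\<tau> (g - V (S g) + cnj \<zeta> *\<^sub>C S g))"
    using N_selfadjoint resolvent_in_N[OF S, of g] resolvent_in_N[OF R, of f] by blast
  then show ?thesis
    by (simp add: blinfun.add_right blinfun.diff_right \<tau>_scaleC cinner_algebra V_symmetric)
qed

end


section \<open>The Krein resolvent formula and its consequences\<close>

text \<open>Two extensions whose data differ by at most \<open>d\<close>. The restriction \<open>d \<le> 1\<close> bounds the data of the
  second extension by those of the first, so that of the second extension only the norm of its
  resolvent enters the constants below.\<close>

locale extension_pair =
  e0: extension D L \<tau> J gnorm T0 P0 N0 V0 + e1: extension D L \<tau> J gnorm T1 P1 N1 V1
  for D :: "'x::chilbert_space set" and L \<tau> and J :: "'y::chilbert_space \<Rightarrow>\<^sub>L 'y" and gnorm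
    and T0 P0 N0 V0 T1 P1 N1 V1 +
  fixes c d :: real
  assumes c: "0 \<le> c" "w \<in> D \<Longrightarrow> norm (T0 w) \<le> c * gnorm w"
    and d: "0 \<le> d" "d \<le> 1" "norm (V1 - V0) \<le> d" "norm (P1 - P0) \<le> d"
      "w \<in> D \<Longrightarrow> norm (T1 w - T0 w) \<le> d * gnorm w"
begin

text \<open>Put \<open>w = R1 f\<close> and \<open>y = S0 g\<close> with \<open>S0 = R0(\<zeta>\<^sup>*)\<close>. Writing \<open>f\<close> and \<open>g\<close> as the images of \<open>w\<close>
  and \<open>y\<close>, the left side is \<open>\<langle>w, \<tau> L y\<rangle> - \<langle>L w, \<tau> y\<rangle> - \<langle>(V1 - V0) w, \<tau> y\<rangle>\<close>, and Green's
  formula turns the first two terms into \<open>- \<langle>J T0 w, T0 y\<rangle>\<close>. Replacing \<open>T0 w\<close> by \<open>T1 w\<close> costs the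
  difference of the traces. Finally \<open>w\<close> and \<open>y\<close> satisfy their own boundary conditions, so that
  \<open>\<langle>J T1 w, T0 y\<rangle>\<close> is the pairing of \<open>P0 J P1 T1 w\<close>, and \<open>P0 J P1 = - P0 (P1 - P0) J\<close> because \<open>J\<close>
  exchanges the range of \<open>P1\<close> with its orthogonal complement.
  Every term on the right contains a difference of data.\<close>

lemma krein_identity:
  assumes R1: "is_resolvent e1.H \<zeta> R1" and R0: "is_resolvent e0.H \<zeta> R0"
    and S0: "is_resolvent e0.H (cnj \<zeta>) S0"
  shows "cinner (R1 f - R0 f) (\<tau> g) =
    cinner ((P1 - P0) (J (T1 (R1 f))) + J (T1 (R1 f) - T0 (R1 f))) (T0 (S0 g))
    - cinner ((V1 - V0) (R1 f)) (\<tau> (S0 g))"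
proof -
  let ?w = "R1 f" and ?y = "S0 g"
  have D: "?w \<in> D" "?y \<in> D"
    by (rule e1.resolvent_in_D[OF R1] e0.resolvent_in_D[OF S0])+
  have f: "f = L ?w + V1 ?w - \<zeta> *\<^sub>C ?w"
    by (simp add: e1.L_resolvent[OF R1])
  have g: "g = L ?y + V0 ?y - cnj \<zeta> *\<^sub>C ?y"
    by (simp add: e0.L_resolvent[OF S0])
  have w: "cinner ?w (\<tau> g) = cinner ?w (\<tau> (L ?y)) + cinner (V0 ?w) (\<tau> ?y) - \<zeta> * cinner ?w (\<tau> ?y)"
    by (subst g) (simp add: blinfun.add_right blinfun.diff_right e0.\<tau>_scaleC cinner_algebra e0.V_symmetric)
  have y: "cinner (R0 f) (\<tau> g) = cinner (L ?w) (\<tau> ?y) + cinner (V1 ?w) (\<tau> ?y) - \<zeta> * cinner ?w (\<tau> ?y)"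
    unfolding e0.resolvent_pairing[OF R0 S0]
    by (subst f) (simp add: cinner_algebra)
  have boundary: "(P1 - P0) (J (T1 ?w)) = - P0 (J (T1 ?w))"
    using e1.P_J[of "T1 ?w"] by (simp add: blinfun.diff_left e1.P_T_resolvent[OF R1])
  have "cinner (P0 (J (T1 ?w))) (T0 ?y) = cinner (J (T1 ?w)) (T0 ?y)"
    by (simp add: e0.P_symmetric e0.P_T_resolvent[OF S0])
  then show ?thesis
    using e0.green[OF D] unfolding boundary
    by (simp add: cinner_algebra w y blinfun.diff_left blinfun.diff_right algebra_simps)
qed

lemma norm_T1_le: "w \<in> D \<Longrightarrow> norm (T1 w) \<le> (c + 1) * gnorm w"
  using d(5)[of w] c(2)[of w] norm_triangle_ineq[of "T1 w - T0 w" "T0 w"]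
    mult_right_mono[OF d(2) e0.gnorm_nonneg[of w]] by (simp add: algebra_simps)

lemma gnorm_R1_le:
  assumes R1: "is_resolvent e1.H \<zeta> R1"
  shows "gnorm (R1 f) \<le> (norm V0 + cmod \<zeta> + 2) * (1 + norm R1) * norm f"
proof -
  have "norm V1 \<le> norm V0 + 1"
    using norm_triangle_ineq2[of V1 V0] d by linarith
  then have "(norm V1 + cmod \<zeta> + 1) * (1 + norm R1) * norm f
      \<le> (norm V0 + cmod \<zeta> + 2) * (1 + norm R1) * norm f"
    by (intro mult_right_mono) auto
  then show ?thesis using e1.gnorm_resolvent_le[OF R1, of f] by linarith
qed

lemma gnorm_S0_le:
  assumes S0: "is_resolvent e0.H \<zeta> S0"
  shows "gnorm (S0 f) \<le> (norm V0 + cmod \<zeta> + 2) * (1 + norm S0) * norm f"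
proof -
  have "(norm V0 + cmod \<zeta> + 1) * (1 + norm S0) * norm f
      \<le> (norm V0 + cmod \<zeta> + 2) * (1 + norm S0) * norm f"
    by (intro mult_right_mono) auto
  then show ?thesis using e0.gnorm_resolvent_le[OF S0, of f] by linarith
qed

lemma gnorm_resolvent_diff_le:
  assumes R1: "is_resolvent e1.H \<zeta> R1" and R0: "is_resolvent e0.H \<zeta> R0"
  shows "gnorm (R1 f - R0 f) \<le> ((norm V0 + cmod \<zeta> + 2) * norm (R1 - R0) + d * norm R1) * norm f"
proof -
  define h where "h = R1 f - R0 f"
  have h: "norm h \<le> norm (R1 - R0) * norm f"
    using norm_blinfun[of "R1 - R0" f] by (simp add: h_def blinfun.diff_left)
  have "L h = L (R1 f) - L (R0 f)"
    unfolding h_def by (rule bounded_on_diff[OF e0.subspace_D e0.L_linear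
          e1.resolvent_in_D[OF R1] e0.resolvent_in_D[OF R0]])
  also have "\<dots> = \<zeta> *\<^sub>C h - V0 h - (V1 - V0) (R1 f)"
    unfolding e1.L_resolvent[OF R1] e0.L_resolvent[OF R0] h_def
    by (simp add: complex_vector.scale_right_diff_distrib blinfun.diff_left blinfun.diff_right)
  finally have L_h: "L h = \<zeta> *\<^sub>C h - V0 h - (V1 - V0) (R1 f)" .
  have "norm (L h) \<le> norm (\<zeta> *\<^sub>C h) + norm (V0 h) + norm ((V1 - V0) (R1 f))"
    unfolding L_h using norm_triangle_ineq4[of "\<zeta> *\<^sub>C h - V0 h" "(V1 - V0) (R1 f)"]
      norm_triangle_ineq4[of "\<zeta> *\<^sub>C h" "V0 h"] by linarith
  also have "norm ((V1 - V0) (R1 f)) \<le> d * (norm R1 * norm f)"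
    by (rule order_trans[OF norm_blinfun_le[OF d(3)] mult_left_mono[OF norm_blinfun d(1)]])
  finally have "gnorm h \<le> norm h + cmod \<zeta> * norm h + norm V0 * norm h + d * (norm R1 * norm f)"
    using e0.gnorm_le[of h] norm_blinfun[of V0 h] by (simp add: norm_scaleC)
  also have "\<dots> \<le> (norm V0 + cmod \<zeta> + 2) * norm h + d * (norm R1 * norm f)"
    by (simp add: algebra_simps)
  also have "\<dots> \<le> (norm V0 + cmod \<zeta> + 2) * (norm (R1 - R0) * norm f) + d * (norm R1 * norm f)"
    by (intro add_right_mono mult_left_mono h) auto
  finally show ?thesis by (simp add: h_def algebra_simps)
qed

text \<open>Since \<open>\<tau>\<close> is an involution, testing with \<open>g = \<tau> h\<close> in a formula for \<open>\<langle>h, \<tau> g\<rangle>\<close> gives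
  \<open>\<parallel>h\<parallel>\<^sup>2\<close>.\<close>

lemma norm_from_pairing:
  fixes h :: 'x
  assumes S0: "is_resolvent e0.H (cnj \<zeta>) S0" "norm S0 \<le> k"
    and h: "cinner h (\<tau> (\<tau> h)) = cinner a (T0 (S0 (\<tau> h))) - cinner b (\<tau> (S0 (\<tau> h)))"
  shows "norm h \<le> (c * norm a + norm b) * ((norm V0 + cmod \<zeta> + 2) * (1 + k))"
proof (cases "h = 0")
  case False
  let ?y = "S0 (\<tau> h)" and ?v = "norm V0 + cmod \<zeta> + 2"
  have y: "?y \<in> D" by (rule e0.resolvent_in_D[OF S0(1)])
  have "norm h * norm h = inner a (T0 ?y) - inner b (\<tau> ?y)"
    using arg_cong[OF h, of Re] by (simp add: inner_cinner flip: power2_eq_square power2_norm_eq_inner)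
      (simp add: power2_norm_eq_inner inner_cinner)
  also have "\<dots> \<le> norm a * norm (T0 ?y) + norm b * norm (\<tau> ?y)"
    using norm_cauchy_schwarz[of a "T0 ?y"] Cauchy_Schwarz_ineq2[of b "\<tau> ?y"] by linarith
  also have "\<dots> \<le> norm a * (c * gnorm ?y) + norm b * gnorm ?y"
    using c(2)[OF y] e0.norm_le_gnorm[of ?y] by (intro add_mono mult_left_mono) auto
  also have "\<dots> = (c * norm a + norm b) * gnorm ?y" by (simp add: algebra_simps)
  also have "\<dots> \<le> (c * norm a + norm b) * (?v * (1 + norm S0) * norm h)"
    using gnorm_S0_le[OF S0(1), of "\<tau> h"] c(1) by (intro mult_left_mono) auto
  also have "\<dots> \<le> (c * norm a + norm b) * (?v * (1 + k) * norm h)"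
    using S0(2) c(1) by (intro mult_left_mono mult_right_mono) auto
  finally show ?thesis using False by (simp add: mult.assoc[symmetric])
qed (use c(1) order_trans[OF norm_ge_zero S0(2)] in auto)

text \<open>The norm of \<open>R1\<close> occurs on both sides. At a point where nothing is known about it, smallness of
  \<open>d\<close> absorbs it into the left side.\<close>

lemma norm_resolvent_diff_le:
  assumes R1: "is_resolvent e1.H \<zeta> R1" and R0: "is_resolvent e0.H \<zeta> R0"
  shows "norm (R1 - R0) \<le> d * ((c + 1)\<^sup>2 * (norm V0 + cmod \<zeta> + 2)\<^sup>2 * (1 + norm R0) * (1 + norm R1))"
proof -
  let ?v = "norm V0 + cmod \<zeta> + 2"
  obtain S0 where S0: "is_resolvent e0.H (cnj \<zeta>) S0" "norm S0 \<le> norm R0"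
    using e0.resolvent_cnj[OF R0] .
  have "norm ((R1 - R0) f) \<le> d * ((c + 1)\<^sup>2 * ?v\<^sup>2 * (1 + norm R0) * (1 + norm R1)) * norm f" for f
  proof -
    define w where "w = R1 f"
    have w: "w \<in> D" unfolding w_def by (rule e1.resolvent_in_D[OF R1])
    define a where "a = (P1 - P0) (J (T1 w)) + J (T1 w - T0 w)"
    define b where "b = (V1 - V0) w"
    have "norm (J (T1 w)) \<le> (c + 1) * gnorm w"
      using e0.norm_J_le[of "T1 w"] norm_T1_le[OF w] by linarith
    then have "norm ((P1 - P0) (J (T1 w))) \<le> d * ((c + 1) * gnorm w)"
      by (rule order_trans[OF norm_blinfun_le[OF d(4)] mult_left_mono[OF _ d(1)]])
    moreover have "norm (J (T1 w - T0 w)) \<le> d * gnorm w"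
      using e0.norm_J_le[of "T1 w - T0 w"] d(5)[OF w] by linarith
    ultimately have a: "norm a \<le> d * ((c + 2) * gnorm w)"
      unfolding a_def using norm_triangle_ineq[of "(P1 - P0) (J (T1 w))" "J (T1 w - T0 w)"]
      by (simp add: algebra_simps)
    have b: "norm b \<le> d * gnorm w"
      unfolding b_def
      by (rule order_trans[OF norm_blinfun_le[OF d(3)] mult_left_mono[OF e0.norm_le_gnorm d(1)]])
    have "norm ((R1 - R0) f) \<le> (c * norm a + norm b) * (?v * (1 + norm R0))"
    proof (rule norm_from_pairing[OF S0])
      let ?h = "(R1 - R0) f"
      show "cinner ?h (\<tau> (\<tau> ?h)) = cinner a (T0 (S0 (\<tau> ?h))) - cinner b (\<tau> (S0 (\<tau> ?h)))"
        using krein_identity[OF R1 R0 S0(1), of f "\<tau> ?h"]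
        unfolding a_def b_def w_def by (simp only: blinfun.diff_left)
    qed
    also have "\<dots> \<le> (c * (d * ((c + 2) * gnorm w)) + d * gnorm w) * (?v * (1 + norm R0))"
      using c(1) by (intro mult_right_mono add_mono mult_left_mono a b) auto
    also have "\<dots> = d * ((c + 1)\<^sup>2 * (?v * (1 + norm R0))) * gnorm w"
      by (simp add: power2_eq_square algebra_simps)
    also have "\<dots> \<le> d * ((c + 1)\<^sup>2 * (?v * (1 + norm R0))) * (?v * (1 + norm R1) * norm f)"
      unfolding w_def using d(1) by (intro mult_left_mono gnorm_R1_le[OF R1]) auto
    also have "\<dots> = d * ((c + 1)\<^sup>2 * ?v\<^sup>2 * (1 + norm R0) * (1 + norm R1)) * norm f"
      by (simp add: power2_eq_square)
    finally show ?thesis .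
  qed
  then show ?thesis using d(1) by (intro norm_blinfun_bound) auto
qed

end

context extension_pair
begin

text \<open>The first-order term is the right side of the Krein identity with the differences of data replaced
  by \<open>s\<close> times their derivatives and \<open>R1\<close> by \<open>R0\<close>. Its remainder therefore consists of linearization
  errors, collected in \<open>e\<close>, and of \<open>s\<close> times the difference of the two resolvents and traces.\<close>

lemma norm_resolvent_remainder_le:
  assumes R1: "is_resolvent e1.H \<zeta> R1" "norm R1 \<le> k"
    and R0: "is_resolvent e0.H \<zeta> R0" "norm R0 \<le> k"
    and S0: "is_resolvent e0.H (cnj \<zeta>) S0"
    and T': "bounded_on D gnorm T'" "\<And>w. w \<in> D \<Longrightarrow> norm (T' w) \<le> c * gnorm w"
    and P': "norm P' \<le> c" and V': "norm V' \<le> c"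
    and e: "0 \<le> e" "norm (V1 - V0 - s *\<^sub>R V') \<le> e" "norm (P1 - P0 - s *\<^sub>R P') \<le> e"
      "\<And>w. w \<in> D \<Longrightarrow> norm (T1 w - T0 w - s *\<^sub>R T' w) \<le> e * gnorm w"
  shows "norm (R1 - R0 - s *\<^sub>R (- (R0 o\<^sub>L V' o\<^sub>L R0)
      + (\<tau> o\<^sub>L cadjoint (comp_blinfun T0 S0) o\<^sub>L (P' o\<^sub>L J) o\<^sub>L comp_blinfun T0 R0)
      + (\<tau> o\<^sub>L cadjoint (comp_blinfun T0 S0) o\<^sub>L J o\<^sub>L comp_blinfun T' R0)))
    \<le> (c + 1) ^ 3 * ((norm V0 + cmod \<zeta> + 2) * (1 + k))\<^sup>2 * (e + \<bar>s\<bar> * (norm (R1 - R0) + 2 * d))"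
    (is "norm (R1 - R0 - s *\<^sub>R ?D) \<le> _")
proof -
  define m where "m = (norm V0 + cmod \<zeta> + 2) * (1 + k)"
  have k: "0 \<le> k" using R0(2) norm_ge_zero order_trans by blast
  have v1: "1 \<le> norm V0 + cmod \<zeta> + 2" by simp
  have "(norm V0 + cmod \<zeta> + 2) * 1 \<le> m"
    unfolding m_def by (rule mult_left_mono) (use k in auto)
  moreover have "1 * (1 + k) \<le> m"
    unfolding m_def by (rule mult_right_mono[OF v1]) (use k in simp)
  ultimately have v_le: "norm V0 + cmod \<zeta> + 2 \<le> m" and k_le: "k \<le> m" and m0: "0 \<le> m"
    using k norm_ge_zero[of V0] norm_ge_zero[of "\<zeta>"] by auto
  obtain S where "is_resolvent e0.H (cnj \<zeta>) S" "norm S \<le> norm R0"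
    using e0.resolvent_cnj[OF R0(1)] .
  then have normS0: "norm S0 \<le> k"
    using is_resolvent_unique[OF S0] R0(2) by fastforce
  have Xc: "comp_blinfun T0 S0 \<in> cbounded"
    by (rule e0.comp_resolvent_cbounded[OF e0.T_bounded S0])
  have adj: "cinner (cadjoint (comp_blinfun T0 S0) u) g = cinner u (T0 (S0 g))" for u g
    using cadjoint_works[OF Xc, of g u] e0.comp_resolvent_apply[OF e0.T_bounded S0, of g]
    by (metis cinner_commute)
  have D_pairing: "cinner (?D f) (\<tau> g) =
      cinner (P' (J (T0 (R0 f))) + J (T' (R0 f))) (T0 (S0 g)) - cinner (V' (R0 f)) (\<tau> (S0 g))" for f g
    by (simp add: blinfun.add_left blinfun.diff_left blinfun.minus_left cinner_algebra e0.\<tau>_symmetric adj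
        e0.resolvent_pairing[OF R0(1) S0] e0.comp_resolvent_apply[OF e0.T_bounded R0(1)]
        e0.comp_resolvent_apply[OF T'(1) R0(1)])
  have "norm ((R1 - R0 - s *\<^sub>R ?D) f) \<le>
      (c + 1) ^ 3 * m\<^sup>2 * (e + \<bar>s\<bar> * (norm (R1 - R0) + 2 * d)) * norm f" for f
  proof -
    define w where "w = R1 f"
    define x where "x = R0 f"
    define g where "g = gnorm w"
    define q where "q = gnorm (w - x)"
    have g0: "0 \<le> g" and q0: "0 \<le> q" by (simp_all add: g_def q_def e0.gnorm_nonneg)
    have w: "w \<in> D" and x: "x \<in> D"
      unfolding w_def x_def by (rule e1.resolvent_in_D[OF R1(1)] e0.resolvent_in_D[OF R0(1)])+
    have wx: "w - x \<in> D" by (rule e0.D_diff[OF w x])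
    have T_diff: "T0 (w - x) = T0 w - T0 x" "T' (w - x) = T' w - T' x"
      by (rule bounded_on_diff[OF e0.subspace_D _ w x] e0.T_bounded T')+
    define a where "a = (P1 - P0) (J (T1 w)) + J (T1 w - T0 w)
      - s *\<^sub>R (P' (J (T0 x)) + J (T' x))"
    define b where "b = (V1 - V0) w - s *\<^sub>R V' x"
    let ?h = "(R1 - R0 - s *\<^sub>R ?D) f"
    have pairing: "cinner ?h (\<tau> g) = cinner a (T0 (S0 g)) - cinner b (\<tau> (S0 g))" for g
    proof -
      have "cinner ?h (\<tau> g) = cinner (R1 f - R0 f) (\<tau> g) - complex_of_real s * cinner (?D f) (\<tau> g)"
        by (simp only: blinfun.diff_left blinfun.scaleR_left scaleR_scaleC cinner_algebra)
      then show ?thesis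
        unfolding krein_identity[OF R1(1) R0(1) S0] D_pairing a_def b_def w_def x_def
        by (simp only: blinfun.diff_left blinfun.scaleR_left scaleR_scaleC cinner_algebra)
           (simp add: algebra_simps)
    qed
    \<comment> \<open>Every term of \<open>a\<close> and \<open>b\<close> is split into the linearization error at \<open>w\<close> and the
      error of replacing \<open>w\<close> by \<open>x\<close> in the linearization.\<close>
    have a_eq: "a = (P1 - P0 - s *\<^sub>R P') (J (T1 w)) + s *\<^sub>R P' (J (T1 w - T0 w))
        + s *\<^sub>R P' (J (T0 (w - x))) + J (T1 w - T0 w - s *\<^sub>R T' w) + s *\<^sub>R J (T' (w - x))"
      unfolding a_def T_diff
      by (simp add: blinfun.diff_left blinfun.diff_right blinfun.scaleR_left blinfun.scaleR_right
          scaleR_diff_right scaleR_add_right)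
    have b_eq: "b = (V1 - V0 - s *\<^sub>R V') w + s *\<^sub>R V' (w - x)"
      unfolding b_def by (simp add: blinfun.diff_left blinfun.diff_right blinfun.scaleR_left scaleR_diff_right)
    have P'J: "norm (P' (J y)) \<le> c * r" if "norm y \<le> r" for y r
      by (rule order_trans[OF norm_blinfun_le[OF P'] mult_left_mono[OF _ c(1)]])
         (use e0.norm_J_le[of y] that in linarith)
    have "norm ((P1 - P0 - s *\<^sub>R P') (J (T1 w))) \<le> e * ((c + 1) * g)"
      by (rule order_trans[OF norm_blinfun_le[OF e(3)] mult_left_mono[OF _ e(1)]])
         (use e0.norm_J_le[of "T1 w"] norm_T1_le[OF w] in \<open>simp add: g_def\<close>)
    moreover have "norm (s *\<^sub>R P' (J (T1 w - T0 w))) \<le> \<bar>s\<bar> * (c * (d * g))"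
      using P'J[OF d(5)[OF w]] by (simp add: g_def mult_left_mono)
    moreover have "norm (s *\<^sub>R P' (J (T0 (w - x)))) \<le> \<bar>s\<bar> * (c * (c * q))"
      using P'J[OF c(2)[OF wx]] by (simp add: q_def mult_left_mono)
    moreover have "norm (J (T1 w - T0 w - s *\<^sub>R T' w)) \<le> e * g"
      using e0.norm_J_le[of "T1 w - T0 w - s *\<^sub>R T' w"] e(4)[OF w] by (simp add: g_def)
    moreover have "norm (s *\<^sub>R J (T' (w - x))) \<le> \<bar>s\<bar> * (c * q)"
      using order_trans[OF e0.norm_J_le T'(2)[OF wx]] by (simp add: q_def mult_left_mono)
    ultimately have a: "norm a \<le> e * ((c + 1) * g) + \<bar>s\<bar> * (c * (d * g)) + \<bar>s\<bar> * (c * (c * q))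
        + e * g + \<bar>s\<bar> * (c * q)"
      unfolding a_eq by (intro norm_triangle_mono)
    have "norm ((V1 - V0 - s *\<^sub>R V') w) \<le> e * g"
      unfolding g_def
      by (rule order_trans[OF norm_blinfun_le[OF e(2)] mult_left_mono[OF e0.norm_le_gnorm e(1)]])
    moreover have "norm (s *\<^sub>R V' (w - x)) \<le> \<bar>s\<bar> * (c * q)"
      using order_trans[OF norm_blinfun_le[OF V'] mult_left_mono[OF e0.norm_le_gnorm c(1)]]
      by (simp add: q_def mult_left_mono)
    ultimately have b: "norm b \<le> e * g + \<bar>s\<bar> * (c * q)"
      unfolding b_eq by (rule norm_triangle_mono)
    have "norm ?h \<le> (c * norm a + norm b) * m"
      unfolding m_def by (rule norm_from_pairing[OF S0 normS0 pairing])
    also have "\<dots> \<le> ((c + 1) ^ 3 * (e * g + \<bar>s\<bar> * (d * g + q))) * m"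
    proof (rule mult_right_mono[OF _ m0])
      have "c * norm a + norm b \<le> c * (e * ((c + 1) * g) + \<bar>s\<bar> * (c * (d * g)) + \<bar>s\<bar> * (c * (c * q))
        + e * g + \<bar>s\<bar> * (c * q)) + (e * g + \<bar>s\<bar> * (c * q))"
        by (intro add_mono mult_left_mono a b c(1))
      also have "\<dots> = (c + 1)\<^sup>2 * (e * g) + c\<^sup>2 * (\<bar>s\<bar> * (d * g)) + (c ^ 3 + c\<^sup>2 + c) * (\<bar>s\<bar> * q)"
        by (simp add: power2_eq_square power3_eq_cube algebra_simps)
      also have "\<dots> \<le> (c + 1) ^ 3 * (e * g) + (c + 1) ^ 3 * (\<bar>s\<bar> * (d * g)) + (c + 1) ^ 3 * (\<bar>s\<bar> * q)"
        using c(1) e(1) d(1) g0 q0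
        by (intro add_mono mult_right_mono) (auto simp: power2_eq_square power3_eq_cube algebra_simps)
      finally show "c * norm a + norm b \<le> (c + 1) ^ 3 * (e * g + \<bar>s\<bar> * (d * g + q))"
        by (simp add: algebra_simps)
    qed
    also have "\<dots> \<le> ((c + 1) ^ 3 * (e * (m * norm f)
        + \<bar>s\<bar> * (d * (m * norm f) + (m * norm (R1 - R0) + d * m) * norm f))) * m"
    proof -
      have "g \<le> m * norm f"
        unfolding g_def w_def m_def
        by (rule order_trans[OF gnorm_R1_le[OF R1(1)]]) (use R1(2) in \<open>auto intro!: mult_right_mono mult_left_mono\<close>)
      moreover have "q \<le> (m * norm (R1 - R0) + d * m) * norm f"
        using gnorm_resolvent_diff_le[OF R1(1) R0(1), of f] unfolding q_def w_def x_def
        by (rule order_trans)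
           (intro mult_right_mono add_mono mult_left_mono v_le order_trans[OF R1(2) k_le] d(1) norm_ge_zero)
      ultimately show ?thesis
        using c(1) e(1) d(1) m0 by (intro mult_right_mono mult_left_mono add_mono) auto
    qed
    also have "\<dots> = (c + 1) ^ 3 * m\<^sup>2 * (e + \<bar>s\<bar> * (norm (R1 - R0) + 2 * d)) * norm f"
      by (simp add: power2_eq_square algebra_simps)
    finally show ?thesis .
  qed
  moreover have "0 \<le> (c + 1) ^ 3 * m\<^sup>2 * (e + \<bar>s\<bar> * (norm (R1 - R0) + 2 * d))"
    using c(1) e(1) d(1) by simp
  ultimately have "norm (R1 - R0 - s *\<^sub>R ?D) \<le>
      (c + 1) ^ 3 * m\<^sup>2 * (e + \<bar>s\<bar> * (norm (R1 - R0) + 2 * d))"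
    by (intro norm_blinfun_bound) auto
  then show ?thesis by (simp only: m_def)
qed

end


section \<open>Stability of the resolvent set\<close>

text \<open>The modulus \<open>d\<close> is kept abstract so that continuity and Lipschitz continuity enter only through
  its behaviour at \<open>t0\<close>.\<close>

locale extension_family = boundary_space D L \<tau> J gnorm
  for D :: "'x::chilbert_space set" and L \<tau> and J :: "'y::chilbert_space \<Rightarrow>\<^sub>L 'y" and gnorm +
  fixes T :: "real \<Rightarrow> 'x \<Rightarrow> 'y" and P :: "real \<Rightarrow> 'y \<Rightarrow>\<^sub>L 'y"
    and N :: "real \<Rightarrow> ('x \<times> 'x) set" and V :: "real \<Rightarrow> 'x \<Rightarrow>\<^sub>L 'x"
    and I :: "real set" and t0 c :: real and d :: "real \<Rightarrow> real"
  assumes ext: "t \<in> I \<Longrightarrow> extension D L \<tau> J gnorm (T t) (P t) (N t) (V t)"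
    and t0: "t0 \<in> I"
    and c: "0 \<le> c" "w \<in> D \<Longrightarrow> norm (T t0 w) \<le> c * gnorm w"
    and d_nonneg: "t \<in> I \<Longrightarrow> 0 \<le> d t"
    and V_dist: "t \<in> I \<Longrightarrow> norm (V t - V t0) \<le> d t"
    and P_dist: "t \<in> I \<Longrightarrow> norm (P t - P t0) \<le> d t"
    and T_dist: "t \<in> I \<Longrightarrow> w \<in> D \<Longrightarrow> norm (T t w - T t0 w) \<le> d t * gnorm w"
begin

abbreviation "H t \<equiv> op_add_bounded (N t) (V t)"

lemma extension_pair_t0:
  assumes "t \<in> I" "d t \<le> 1"
  shows "extension_pair D L \<tau> J gnorm (T t0) (P t0) (N t0) (V t0) (T t) (P t) (N t) (V t) c (d t)"
  using assms ext t0 c d_nonneg V_dist P_dist T_dist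
  by (intro extension_pair.intro extension_pair_axioms.intro) auto

text \<open>At the common resolvent point \<open>z\<close> the resolvents converge in norm as \<open>t\<close> tends to \<open>t0\<close>. The
  operator \<open>1 - (\<zeta> - z) R_t(z)\<close> is therefore norm continuous at \<open>(t0, \<zeta>0)\<close>, where it is invertible
  because \<open>\<zeta>0\<close> is a resolvent point for \<open>t0\<close>. It stays invertible nearby with a uniformly bounded
  inverse, which bounds \<open>R_t(\<zeta>)\<close>, and the estimate of the difference applies at \<open>\<zeta>\<close> itself.\<close>

lemma resolvent_set_stable:
  assumes d_lim: "(d \<longlongrightarrow> 0) (nhds t0)"
    and z: "\<forall>\<^sub>F t in nhds t0. z \<notin> spectrum (H t)"
    and \<zeta>0: "\<zeta>0 \<notin> spectrum (H t0)"
  obtains \<epsilon> k where "0 < \<epsilon>" "0 < k"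
    "\<And>t \<zeta>. t \<in> I \<Longrightarrow> \<bar>t - t0\<bar> \<le> \<epsilon> \<Longrightarrow> cmod (\<zeta> - \<zeta>0) \<le> \<epsilon> \<Longrightarrow>
       d t \<le> 1 \<and> \<zeta> \<notin> spectrum (H t) \<and> norm (resolvent (H t) \<zeta>) \<le> k \<and>
       norm (resolvent (H t) \<zeta> - resolvent (H t0) \<zeta>) \<le> k * d t"
proof -
  define r0 where "r0 = norm (resolvent (H t0) z)"
  define X where "X = shift_factor (\<zeta>0 - z) (resolvent (H t0) z)"
  define Y where "Y = shift_factor (z - \<zeta>0) (resolvent (H t0) \<zeta>0)"
  define y where "y = norm Y"
  define C where "C = (c + 1)\<^sup>2 * (norm (V t0) + cmod z + 2)\<^sup>2 * (1 + r0)"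
  define C' where "C' = C * (2 * r0 + 2)"
  have nonneg: "0 \<le> r0" "0 \<le> y" "0 \<le> C" "0 \<le> C'"
    by (simp_all add: r0_def y_def C_def C'_def)
  have "\<forall>\<^sub>F t in nhds t0. d t < 1" "\<forall>\<^sub>F t in nhds t0. d t * C < 1 / 2"
    "\<forall>\<^sub>F t in nhds t0. d t * (y * (cmod (\<zeta>0 - z) + 1) * C') < 1 / 4"
    by (rule order_tendstoD(2)[OF d_lim] order_tendstoD(2)[OF tendsto_mult_left_zero[OF d_lim]]; simp)+
  with z have "\<forall>\<^sub>F t in nhds t0. z \<notin> spectrum (H t) \<and> d t < 1 \<and> d t * C < 1 / 2 \<and>
      d t * (y * (cmod (\<zeta>0 - z) + 1) * C') < 1 / 4"
    by (intro eventually_conj)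
  then obtain \<delta> where "0 < \<delta>" and near: "\<And>t. \<bar>t - t0\<bar> < \<delta> \<Longrightarrow> z \<notin> spectrum (H t) \<and> d t < 1 \<and>
      d t * C < 1 / 2 \<and> d t * (y * (cmod (\<zeta>0 - z) + 1) * C') < 1 / 4"
    unfolding eventually_nhds_metric dist_real_def by blast
  define \<epsilon> where "\<epsilon> = min 1 (min (\<delta> / 2) (1 / (4 * (r0 * y + 1))))"
  have \<epsilon>: "0 < \<epsilon>" "\<epsilon> \<le> 1" "\<epsilon> < \<delta>" "\<epsilon> * (r0 * y) \<le> 1 / 4"
  proof -
    have pos: "0 < r0 * y + 1" using nonneg by (simp add: add_nonneg_pos)
    show "0 < \<epsilon>" "\<epsilon> \<le> 1" "\<epsilon> < \<delta>" using \<open>0 < \<delta>\<close> pos by (auto simp: \<epsilon>_def)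
    have "\<epsilon> * (r0 * y) \<le> 1 / (4 * (r0 * y + 1)) * (r0 * y)"
      using nonneg by (intro mult_right_mono) (auto simp: \<epsilon>_def)
    also have "\<dots> \<le> 1 / 4" using pos by (simp add: field_simps)
    finally show "\<epsilon> * (r0 * y) \<le> 1 / 4" .
  qed
  have R0z: "is_resolvent (H t0) z (resolvent (H t0) z)"
    and R0\<zeta>0: "is_resolvent (H t0) \<zeta>0 (resolvent (H t0) \<zeta>0)"
    using near[of t0] \<open>0 < \<delta>\<close> \<zeta>0 by (auto intro: is_resolvent_resolvent)
  have XY: "X \<in> cbounded" "Y \<in> cbounded" "\<And>x. Y (X x) = x" "\<And>x. X (Y x) = x"
    using R0z R0\<zeta>0 shift_factor_inverse[OF R0z R0\<zeta>0] shift_factor_inverse[OF R0\<zeta>0 R0z]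
    by (auto simp: X_def Y_def is_resolvent_iff intro: shift_factor_cbounded)
  define k1 where "k1 = (2 * r0 + 1) * (2 * y)"
  have k1: "0 \<le> k1" using nonneg by (simp add: k1_def)
  have resolvent_near: "is_resolvent (H t) \<zeta> (resolvent (H t) \<zeta>) \<and> norm (resolvent (H t) \<zeta>) \<le> k1"
    if t: "t \<in> I" "\<bar>t - t0\<bar> \<le> \<epsilon>" and \<zeta>: "cmod (\<zeta> - \<zeta>0) \<le> \<epsilon>" for t \<zeta>
  proof -
    have t_near: "z \<notin> spectrum (H t)" "d t \<le> 1" "d t * C \<le> 1 / 2"
        "d t * (y * (cmod (\<zeta>0 - z) + 1) * C') \<le> 1 / 4"
      using near[of t] t(2) \<epsilon>(3) by auto
    define Rz where "Rz = resolvent (H t) z"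
    have Rz: "is_resolvent (H t) z Rz"
      unfolding Rz_def by (rule is_resolvent_resolvent[OF t_near(1)])
    have diff: "norm (Rz - resolvent (H t0) z) \<le> d t * (C * (1 + norm Rz))"
      using extension_pair.norm_resolvent_diff_le[OF extension_pair_t0[OF t(1) t_near(2)] Rz R0z]
      by (simp add: C_def r0_def mult.assoc)
    \<comment> \<open>Absorption: half of \<open>norm Rz\<close> moves to the left side.\<close>
    have "d t * C * (1 + norm Rz) \<le> 1 / 2 * (1 + norm Rz)"
      by (intro mult_right_mono t_near) auto
    then have norm_Rz: "norm Rz \<le> 2 * r0 + 1"
      using diff norm_triangle_ineq2[of Rz "resolvent (H t0) z"] by (simp add: r0_def algebra_simps)
    have "d t * (C * (1 + norm Rz)) \<le> d t * C'"
      unfolding C'_def using norm_Rz nonneg d_nonneg[OF t(1)] by (intro mult_left_mono) auto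
    then have diff': "norm (Rz - resolvent (H t0) z) \<le> d t * C'" using diff by linarith
    define Z where "Z = shift_factor (\<zeta> - z) Rz"
    have "cmod (\<zeta> - z) \<le> cmod (\<zeta>0 - z) + 1"
      using norm_triangle_ineq[of "\<zeta> - \<zeta>0" "\<zeta>0 - z"] \<zeta> \<epsilon>(2) by simp
    then have "norm (Z - X) \<le> (cmod (\<zeta>0 - z) + 1) * (d t * C') + \<epsilon> * r0"
      unfolding Z_def X_def
      using \<zeta> diff' \<epsilon>(1) by (intro order_trans[OF norm_shift_factor_diff] add_mono mult_mono)
        (auto simp: r0_def)
    then have "y * norm (Z - X) \<le> y * ((cmod (\<zeta>0 - z) + 1) * (d t * C') + \<epsilon> * r0)"
      by (rule mult_left_mono[OF _ nonneg(2)])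
    also have "\<dots> \<le> 1 / 2"
      using t_near(4) \<epsilon>(4) by (simp add: algebra_simps)
    finally have small: "norm Y * norm (Z - X) \<le> 1 / 2" by (simp add: y_def)
    have "Z \<in> cbounded"
      using Rz unfolding Z_def by (auto simp: is_resolvent_iff intro: shift_factor_cbounded)
    then obtain W where W: "W \<in> cbounded" "\<And>x. W (Z x) = x" "\<And>x. Z (W x) = x" "norm W \<le> 2 * norm Y"
      using perturbed_inverse[OF XY(1,2) _ XY(3,4) small] by blast
    have res: "is_resolvent (H t) \<zeta> (Rz o\<^sub>L W)"
      by (rule is_resolvent_via_shift_factor[OF Rz W(1)]) (use W(2,3) in \<open>simp_all add: Z_def\<close>)
    have "norm (Rz o\<^sub>L W) \<le> norm Rz * norm W" by (rule norm_blinfun_compose)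
    also have "\<dots> \<le> k1"
      unfolding k1_def y_def using norm_Rz W(4) nonneg by (intro mult_mono) auto
    finally show ?thesis using res resolvent_eqI[OF res] by simp
  qed
  define k2 where "k2 = (c + 1)\<^sup>2 * (norm (V t0) + cmod \<zeta>0 + 3)\<^sup>2 * (1 + k1) * (1 + k1)"
  have k2: "0 \<le> k2" using k1 by (simp add: k2_def)
  show thesis
  proof (rule that[OF \<epsilon>(1), of "k1 + k2 + 1"], goal_cases)
    case (2 t \<zeta>)
    have d1: "d t \<le> 1" using near[of t] 2(2) \<epsilon>(3) by auto
    note Rt = resolvent_near[OF 2] and R0 = resolvent_near[OF t0 _ 2(3), simplified]
    have "cmod \<zeta> \<le> cmod \<zeta>0 + 1"
      using norm_triangle_ineq2[of \<zeta> \<zeta>0] 2(3) \<epsilon>(2) by linarith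
    have "norm (resolvent (H t) \<zeta> - resolvent (H t0) \<zeta>) \<le>
        d t * ((c + 1)\<^sup>2 * (norm (V t0) + cmod \<zeta> + 2)\<^sup>2 * (1 + norm (resolvent (H t0) \<zeta>))
           * (1 + norm (resolvent (H t) \<zeta>)))"
      using extension_pair.norm_resolvent_diff_le[OF extension_pair_t0[OF 2(1) d1]] Rt R0 \<epsilon>(1) by simp
    also have "\<dots> \<le> d t * k2"
      unfolding k2_def using Rt R0 \<epsilon>(1) k1 d_nonneg[OF 2(1)] \<open>cmod \<zeta> \<le> cmod \<zeta>0 + 1\<close>
      by (intro mult_left_mono mult_mono power_mono) auto
    also have "\<dots> \<le> (k1 + k2 + 1) * d t"
      using k1 d_nonneg[OF 2(1)] by (simp add: algebra_simps)
    finally show ?case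
      using d1 Rt not_in_spectrumI k2 by fastforce
  qed (use k1 k2 in simp)
qed

end


section \<open>Adjoints, Lagrangian projections and block operators\<close>

lemma orthogonal_to_dense:
  assumes "closure S = UNIV" "\<And>u. u \<in> S \<Longrightarrow> inner u h = 0"
  shows "h = 0"
proof -
  have "closed {u. inner u h = 0}"
    by (intro closed_Collect_eq continuous_intros)
  then have "closure S \<subseteq> {u. inner u h = 0}"
    using assms(2) by (intro closure_minimal) auto
  then have "inner h h = 0" using assms(1) by blast
  then show ?thesis by simp
qed

lemma op_adjoint_iff:
  "(v, w) \<in> op_adjoint G \<longleftrightarrow> (\<forall>(u, u')\<in>G. cinner u' v = cinner u w)"
  by (simp add: op_adjoint_def)

lemma op_adjoint_single_valued:
  assumes "densely_defined G" "(v, w) \<in> op_adjoint G" "(v, w') \<in> op_adjoint G"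
  shows "w = w'"
proof -
  have "inner u (w - w') = 0" if u: "u \<in> Domain G" for u
  proof -
    obtain u' where "(u, u') \<in> G" using u by auto
    then have "cinner u w = cinner u w'"
      using assms(2,3) unfolding op_adjoint_iff by (metis (mono_tags, lifting) case_prodD)
    then show ?thesis by (simp add: inner_cinner cinner_diff_right)
  qed
  then have "w - w' = 0"
    using assms(1) unfolding densely_defined_def by (rule orthogonal_to_dense[rotated])
  then show ?thesis by simp
qed

lemma op_apply_op_adjoint:
  assumes "densely_defined G" "(v, w) \<in> op_adjoint G"
  shows "op_apply (op_adjoint G) v = w"
  unfolding op_apply_def
  using assms by (blast intro: the_equality op_adjoint_single_valued)

lemma op_adjoint_add:
  "(v, w) \<in> op_adjoint G \<Longrightarrow> (v', w') \<in> op_adjoint G \<Longrightarrow> (v + v', w + w') \<in> op_adjoint G"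
  by (fastforce simp: op_adjoint_iff cinner_add_right)

lemma op_adjoint_scaleC:
  "(v, w) \<in> op_adjoint G \<Longrightarrow> (c *\<^sub>C v, c *\<^sub>C w) \<in> op_adjoint G"
  by (fastforce simp: op_adjoint_iff cinner_scaleC_right)

lemma subspace_Domain_op_adjoint: "complex_vector.subspace (Domain (op_adjoint G))"
proof -
  have "(0, 0) \<in> op_adjoint G" by (auto simp: op_adjoint_iff)
  then show ?thesis
    unfolding complex_vector.subspace_def by (blast intro: op_adjoint_add op_adjoint_scaleC)
qed

lemma op_adjoint_antimono: "G \<subseteq> G' \<Longrightarrow> op_adjoint G' \<subseteq> op_adjoint G"
  unfolding op_adjoint_def by blast

lemma op_J_apply [simp]: "op_J (a, b) = (b, - a)"
  by (simp add: op_J_def block_offdiag.rep_eq blinfun.minus_left)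

lemma op_tau_apply [simp]: "op_tau (a, b) = (b, a)"
  by (simp add: op_tau_def block_offdiag.rep_eq)

lemma block_diag_apply [simp]: "blinfun_apply (block_diag X Y) (u, v) = (X u, Y v)"
  by (simp add: block_diag.rep_eq)

lemma block_offdiag_apply [simp]: "blinfun_apply (block_offdiag X Y) (u, v) = (X v, Y u)"
  by (simp add: block_offdiag.rep_eq)

lemma op_JJ_apply [simp]: "op_JJ (a, b) = (op_J a, - op_J b)"
  by (simp add: op_JJ_def blinfun.minus_left)

lemma cinner_Pair [simp]: "cinner (a, b) (x, y) = cinner a x + cinner b y"
  by (simp add: cinner_prod_def)

lemma scaleC_Pair [simp]: "c *\<^sub>C (a, b) = (c *\<^sub>C a, c *\<^sub>C b)"
  by (simp add: scaleC_prod_def)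

lemma op_J_op_J: "op_J (op_J x) = - x"
  by (cases x) simp

lemma op_J_skew: "cinner (op_J x) y = - cinner x (op_J y)"
  by (cases x; cases y) (simp add: cinner_minus_left cinner_minus_right)

lemma norm_op_J: "norm (op_J x) = norm x"
  by (cases x) (simp add: norm_Pair add.commute)

lemma norm_op_JJ: "norm (op_JJ x) = norm x"
  by (cases x) (simp add: norm_Pair norm_op_J)

lemma norm_block_diag_le:
  fixes X :: "'a::real_normed_vector \<Rightarrow>\<^sub>L 'c::real_normed_vector"
    and Y :: "'b::real_normed_vector \<Rightarrow>\<^sub>L 'd::real_normed_vector"
  shows "norm (block_diag X Y) \<le> norm X + norm Y"
proof (rule norm_blinfun_bound)
  fix p :: "'a \<times> 'b"
  obtain u v where p: "p = (u, v)" by (cases p)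
  have "norm (X u) \<le> norm X * norm p" "norm (Y v) \<le> norm Y * norm p"
    using norm_fst_le[of u v] norm_snd_le[of v u] unfolding p
    by (auto intro: order_trans[OF norm_blinfun mult_left_mono])
  then show "norm (block_diag X Y p) \<le> (norm X + norm Y) * norm p"
    using norm_Pair_le[of "X u" "Y v"] unfolding p by (simp add: algebra_simps)
qed simp

lemma block_diag_diff: "block_diag X Y - block_diag X' Y' = block_diag (X - X') (Y - Y')"
  by (rule blinfun_eqI) (auto simp: blinfun.diff_left)

lemma block_diag_scaleR: "s *\<^sub>R block_diag X Y = block_diag (s *\<^sub>R X) (s *\<^sub>R Y)"
  by (rule blinfun_eqI) (auto simp: blinfun.scaleR_left)

text \<open>For a projection \<open>P\<close> onto a Lagrangian subspace, \<open>P J P = 0\<close> says that the range is isotropic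
  and \<open>P J = J (1 - P)\<close> that \<open>J\<close> exchanges it with its orthogonal complement. The second follows
  from the first by maximality: \<open>J (1 - P) x\<close> annihilates the range and so lies in it.\<close>

lemma lagrangian_projection_op_J:
  assumes P: "orthogonal_projection P" and lag: "lagrangian (range P)"
  shows "P (op_J x) = op_J x - op_J (P x)"
proof -
  have sym: "cinner (P u) v = cinner u (P v)" for u v
    using P unfolding orthogonal_projection_def bounded_selfadjoint_def by blast
  have idem: "P (P u) = P u" for u
    using P unfolding orthogonal_projection_def by (metis blinfun_apply_blinfun_compose)
  have range: "range P = {g. \<forall>f\<in>range P. cinner (op_J f) g = 0}"
    using lag unfolding lagrangian_def by blast
  have isotropic: "P (op_J (P u)) = 0" for u
  proof (rule cinner_cancel_right)
    fix v
    have "P v \<in> {g. \<forall>f\<in>range P. cinner (op_J f) g = 0}" using range by blast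
    then have "cinner (op_J (P u)) (P v) = 0" by blast
    then show "cinner v (P (op_J (P u))) = cinner v 0"
      by (metis cinner_commute cinner_zero_right complex_cnj_zero sym)
  qed
  let ?g = "op_J (x - P x)"
  have "cinner (op_J (P u)) ?g = 0" for u
  proof -
    have "cinner (op_J (P u)) ?g = cinner (P u) (x - P x)"
      by (simp add: op_J_skew op_J_op_J cinner_minus_right cinner_diff_right)
    also have "\<dots> = 0" by (simp add: sym blinfun.diff_right idem)
    finally show ?thesis .
  qed
  then have "?g \<in> range P" by (subst range) blast
  then have "P ?g = ?g" using idem by auto
  then show ?thesis using isotropic[of x] by (simp add: blinfun.diff_right)
qed


section \<open>The boundary space of a symmetric operator\<close>

definition offdiag_max :: "('h::complex_inner \<times> 'h) set \<Rightarrow> 'h \<times> 'h \<Rightarrow> 'h \<times> 'h"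
  where "offdiag_max A w = (- op_apply (op_adjoint A) (snd w), op_apply (op_adjoint A) (fst w))"

abbreviation "graph_norm2 A \<equiv> pair_norm (graph_norm (op_adjoint A))"

abbreviation "dom2 A \<equiv> Domain (op_adjoint A) \<times> Domain (op_adjoint A)"

lemma pair_norm_graph_norm: "graph_norm2 A = (\<lambda>w. norm (w, offdiag_max A w))"
  by (rule ext) (simp add: pair_norm_def graph_norm_def offdiag_max_def norm_prod_def)

lemma fst_snd_le_pair_norm:
  assumes "0 \<le> n (fst p)" "0 \<le> n (snd p)"
  shows "n (fst p) \<le> pair_norm n p" "n (snd p) \<le> pair_norm n p"
  using assms norm_fst_le[of "n (fst p)" "n (snd p)"] norm_snd_le[of "n (snd p)" "n (fst p)"]
  by (simp_all add: pair_norm_def)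

lemma boundary_space_offdiag_max:
  fixes A :: "('h::chilbert_space \<times> 'h) set"
  assumes A: "densely_defined A"
  shows "boundary_space (dom2 A) (offdiag_max A) op_tau
    (op_JJ :: (('k::chilbert_space \<times> 'k) \<times> ('k \<times> 'k)) \<Rightarrow>\<^sub>L _) (graph_norm2 A)"
proof
  let ?a = "op_apply (op_adjoint A)"
  have in_adj: "(u, ?a u) \<in> op_adjoint A" if "u \<in> Domain (op_adjoint A)" for u
    using that op_apply_op_adjoint[OF A] by auto
  show "complex_vector.subspace (dom2 A)"
    using subspace_Domain_op_adjoint[of A]
    by (auto simp: complex_vector.subspace_def zero_prod_def)
  have "?a (u + v) = ?a u + ?a v" "?a (c *\<^sub>C u) = c *\<^sub>C ?a u"
    if "u \<in> Domain (op_adjoint A)" "v \<in> Domain (op_adjoint A)" for u v c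
    using in_adj[OF that(1)] in_adj[OF that(2)]
    by (auto intro!: op_apply_op_adjoint[OF A] op_adjoint_add op_adjoint_scaleC)
  then show "bounded_on (dom2 A) (graph_norm2 A) (offdiag_max A)"
    unfolding bounded_on_def
    by (auto simp: offdiag_max_def pair_norm_graph_norm complex_vector.scale_minus_right
        intro!: exI[of _ 1] norm_snd_le)
  show "op_tau \<in> (cbounded :: (('h \<times> 'h) \<Rightarrow>\<^sub>L ('h \<times> 'h)) set)"
    by (auto simp: cbounded_iff)
  show "op_tau (op_tau x) = x" for x :: "'h \<times> 'h" by (cases x) simp
  show "cinner (op_tau x) y = cinner x (op_tau y)" for x y :: "'h \<times> 'h"
    by (cases x; cases y) (simp add: add.commute)
qed (simp_all add: norm_op_JJ pair_norm_graph_norm)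

lemma bounded_on_map_prod:
  assumes f: "bounded_on S n f" and n: "\<And>x. 0 \<le> n x"
  shows "bounded_on (S \<times> S) (pair_norm n) (map_prod f f)"
proof -
  obtain K where K: "0 \<le> K" "\<And>x. x \<in> S \<Longrightarrow> norm (f x) \<le> K * n x"
    using bounded_on_obtain_bound[OF f n] by blast
  have "norm (map_prod f f p) \<le> (2 * K) * pair_norm n p" if pS: "p \<in> S \<times> S" for p
  proof -
    obtain u v where p: "p = (u, v)" "u \<in> S" "v \<in> S" using pS by auto
    have "norm (f u, f v) \<le> norm (f u) + norm (f v)" by (rule norm_Pair_le)
    also have "\<dots> \<le> K * pair_norm n p + K * pair_norm n p"
      using fst_snd_le_pair_norm[of n p, OF n n] K p
      by (intro add_mono order_trans[OF K(2) mult_left_mono]) auto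
    finally show ?thesis by (simp add: p)
  qed
  then show ?thesis
    using f unfolding bounded_on_def by (auto simp: map_prod_def split: prod.splits)
qed

lemma selfadjoint_restriction:
  assumes A: "densely_defined A" and B: "selfadjoint_op B" "A \<subseteq> B" "(u, w) \<in> B"
  shows "u \<in> Domain (op_adjoint A)" "op_apply (op_adjoint A) u = w"
proof -
  have "(u, w) \<in> op_adjoint A"
    using B op_adjoint_antimono[OF B(2)] by (auto simp: selfadjoint_op_def)
  then show "u \<in> Domain (op_adjoint A)" "op_apply (op_adjoint A) u = w"
    using op_apply_op_adjoint[OF A] by auto
qed

text \<open>Green's formula for \<open>dom A\<^sup>* \<times> dom A\<^sup>*\<close> is the difference of the given formulas for the two
  components, which is why the boundary form is \<open>J \<oplus> (- J)\<close>. Twisted self-adjointness of the block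
  operator decouples into self-adjointness of its two entries: \<open>\<tau>\<close> moves the entry \<open>AA\<close> acting on
  the first component back to the first component, and likewise for \<open>BB\<close>.\<close>

lemma extension_offdiag:
  fixes A AA BB :: "('h::chilbert_space \<times> 'h) set" and tr :: "'h \<Rightarrow> 'k::chilbert_space \<times> 'k"
  assumes A: "densely_defined A"
    and tr: "bounded_on (Domain (op_adjoint A)) (graph_norm (op_adjoint A)) tr"
    and green: "\<And>u v. u \<in> Domain (op_adjoint A) \<Longrightarrow> v \<in> Domain (op_adjoint A) \<Longrightarrow>
      cinner (op_apply (op_adjoint A) u) v - cinner u (op_apply (op_adjoint A) v) =
      cinner (snd (tr u)) (fst (tr v)) - cinner (fst (tr u)) (snd (tr v))"
    and P: "orthogonal_projection P" "lagrangian (range P)"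
    and Q: "orthogonal_projection Q" "lagrangian (range Q)"
    and AA: "selfadjoint_op AA" "A \<subseteq> AA" "tr ` Domain AA = range P"
    and BB: "selfadjoint_op BB" "A \<subseteq> BB" "tr ` Domain BB = range Q"
    and FG: "bounded_selfadjoint F" "bounded_selfadjoint G"
  shows "extension (dom2 A) (offdiag_max A) op_tau op_JJ (graph_norm2 A) (map_prod tr tr)
    (block_diag P Q) (op_offdiag (op_uminus BB) AA) (block_offdiag (- G) F)"
proof -
  interpret boundary_space "dom2 A" "offdiag_max A" op_tau
      "op_JJ :: (('k \<times> 'k) \<times> ('k \<times> 'k)) \<Rightarrow>\<^sub>L _" "graph_norm2 A"
    by (rule boundary_space_offdiag_max[OF A])
  have proj: "cinner (X u) v = cinner u (X v)" "u \<in> range X \<Longrightarrow> X u = u"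
    if "orthogonal_projection X" for X :: "('k \<times> 'k) \<Rightarrow>\<^sub>L ('k \<times> 'k)" and u v
    using that unfolding orthogonal_projection_def bounded_selfadjoint_def
    by blast (metis blinfun_apply_blinfun_compose imageE that orthogonal_projection_def)
  show ?thesis
  proof
    show "bounded_on (dom2 A) (graph_norm2 A) (map_prod tr tr)"
      by (rule bounded_on_map_prod[OF tr]) (simp add: graph_norm_def)
    show "cinner (offdiag_max A u) (op_tau v) - cinner u (op_tau (offdiag_max A v)) =
        cinner (op_JJ (map_prod tr tr u)) (map_prod tr tr v)"
      if "u \<in> dom2 A" "v \<in> dom2 A" for u v
    proof -
      obtain u1 u2 v1 v2 where uv: "u = (u1, u2)" "v = (v1, v2)" by (cases u; cases v)
      have J: "cinner (op_J (tr x)) (tr y) = cinner (snd (tr x)) (fst (tr y)) - cinner (fst (tr x)) (snd (tr y))" for x y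
        by (cases "tr x"; cases "tr y") (simp add: cinner_minus_left)
      have "cinner (offdiag_max A u) (op_tau v) - cinner u (op_tau (offdiag_max A v)) =
          (cinner (op_apply (op_adjoint A) u1) v1 - cinner u1 (op_apply (op_adjoint A) v1)) -
          (cinner (op_apply (op_adjoint A) u2) v2 - cinner u2 (op_apply (op_adjoint A) v2))"
        by (simp add: uv offdiag_max_def cinner_minus_left cinner_minus_right)
      also have "\<dots> = cinner (op_J (tr u1)) (tr v1) - cinner (op_J (tr u2)) (tr v2)"
        using that by (simp add: uv green J)
      finally show ?thesis by (simp add: uv cinner_minus_left)
    qed
    show "cinner (block_diag P Q k) l = cinner k (block_diag P Q l)" for k l
      by (cases k; cases l) (simp add: proj(1)[OF P(1)] proj(1)[OF Q(1)])
    show "block_diag P Q (op_JJ k) = op_JJ k - op_JJ (block_diag P Q k)" for k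
      by (rule prod.exhaust[of k])
         (simp add: lagrangian_projection_op_J[OF P] lagrangian_projection_op_J[OF Q] blinfun.minus_right)
    show "u \<in> dom2 A \<and> w = offdiag_max A u \<and> block_diag P Q (map_prod tr tr u) = map_prod tr tr u"
      if "(u, w) \<in> op_offdiag (op_uminus BB) AA" for u w
    proof -
      obtain u1 u2 a b where uw: "u = (u1, u2)" "w = (- b, a)" "(u1, a) \<in> AA" "(u2, b) \<in> BB"
        using \<open>(u, w) \<in> _\<close> by (auto simp: op_offdiag_def op_uminus_def)
      have "tr u1 \<in> range P" "tr u2 \<in> range Q"
        unfolding AA(3)[symmetric] BB(3)[symmetric] using uw(3,4) by auto
      then have "P (tr u1) = tr u1" "Q (tr u2) = tr u2"
        using proj(2)[OF P(1)] proj(2)[OF Q(1)] by blast+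
      then show ?thesis
        using selfadjoint_restriction[OF A AA(1,2) uw(3)] selfadjoint_restriction[OF A BB(1,2) uw(4)]
        by (simp add: uw(1,2) offdiag_max_def)
    qed
    show "(v, v') \<in> op_offdiag (op_uminus BB) AA \<longleftrightarrow>
        (\<forall>(u, u')\<in>op_offdiag (op_uminus BB) AA. cinner u' (op_tau v) = cinner u (op_tau v'))" for v v'
    proof -
      obtain v1 v2 b a where v: "v = (v1, v2)" "v' = (b, a)" by (cases v; cases v')
      have AA_iff: "(v1, a) \<in> AA \<longleftrightarrow> (\<forall>(u, u')\<in>AA. cinner u' v1 = cinner u a)"
        and BB_iff: "(v2, - b) \<in> BB \<longleftrightarrow> (\<forall>(u, u')\<in>BB. cinner u' v2 = cinner u (- b))"
        using AA(1) BB(1) by (metis op_adjoint_iff selfadjoint_op_def)+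
      \<comment> \<open>Testing with \<open>0\<close> in one component isolates the condition on the other.\<close>
      have zero: "(0, 0) \<in> AA" "(0, 0) \<in> BB"
        using AA(1) BB(1) complex_vector.subspace_0
        by (fastforce simp: selfadjoint_op_def linear_operator_def zero_prod_def)+
      have "(v, v') \<in> op_offdiag (op_uminus BB) AA \<longleftrightarrow> (v1, a) \<in> AA \<and> (v2, - b) \<in> BB"
        by (force simp: op_offdiag_def op_uminus_def v)
      also have "\<dots> \<longleftrightarrow> (\<forall>u1 a' u2 b'. (u1, a') \<in> AA \<longrightarrow> (u2, b') \<in> BB \<longrightarrow>
          cinner (- b') v2 + cinner a' v1 = cinner u1 a + cinner u2 b)"
      proof
        assume r: "\<forall>u1 a' u2 b'. (u1, a') \<in> AA \<longrightarrow> (u2, b') \<in> BB \<longrightarrow>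
          cinner (- b') v2 + cinner a' v1 = cinner u1 a + cinner u2 b"
        have "\<forall>(u, u')\<in>AA. cinner u' v1 = cinner u a"
          using r zero(2) by fastforce
        moreover have "\<forall>(u, u')\<in>BB. cinner u' v2 = cinner u (- b)"
        proof clarify
          fix u u' assume "(u, u') \<in> BB"
          then have "cinner (- u') v2 + cinner 0 v1 = cinner 0 a + cinner u b"
            using r zero(1) by blast
          then show "cinner u' v2 = cinner u (- b)"
            by (simp add: cinner_minus_left cinner_minus_right) (metis minus_minus)
        qed
        ultimately show "(v1, a) \<in> AA \<and> (v2, - b) \<in> BB" using AA_iff BB_iff by blast
      next
        assume "(v1, a) \<in> AA \<and> (v2, - b) \<in> BB"
        then have "\<forall>(u, u')\<in>AA. cinner u' v1 = cinner u a"
          "\<forall>(u, u')\<in>BB. cinner u' v2 = cinner u (- b)"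
          using AA_iff BB_iff by blast+
        then show "\<forall>u1 a' u2 b'. (u1, a') \<in> AA \<longrightarrow> (u2, b') \<in> BB \<longrightarrow>
          cinner (- b') v2 + cinner a' v1 = cinner u1 a + cinner u2 b"
          by (fastforce simp: cinner_minus_left cinner_minus_right)
      qed
      also have "\<dots> \<longleftrightarrow>
        (\<forall>(u, u')\<in>op_offdiag (op_uminus BB) AA. cinner u' (op_tau v) = cinner u (op_tau v'))"
        by (fastforce simp: op_offdiag_def op_uminus_def v)
      finally show ?thesis .
    qed
    show "cinner (block_offdiag (- G) F u) (op_tau v) = cinner u (op_tau (block_offdiag (- G) F v))" for u v
      using FG by (cases u; cases v)
        (simp add: bounded_selfadjoint_def blinfun.minus_left cinner_minus_left cinner_minus_right add.commute)
  qed
qed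


section \<open>Operator norms on a subspace and moduli of continuity\<close>

lemma bounded_on_diff_fun:
  assumes "bounded_on S n f" "bounded_on S n g" "\<And>x. x \<in> S \<Longrightarrow> 0 \<le> n x"
  shows "bounded_on S n (\<lambda>x. f x - g x)"
proof -
  obtain K K' where K: "\<And>x. x \<in> S \<Longrightarrow> norm (f x) \<le> K * n x" "\<And>x. x \<in> S \<Longrightarrow> norm (g x) \<le> K' * n x"
    using assms(1,2) unfolding bounded_on_def by blast
  have "norm (f x - g x) \<le> (K + K') * n x" if "x \<in> S" for x
    using K[OF that] norm_triangle_ineq4[of "f x" "g x"] by (simp add: algebra_simps)
  then show ?thesis
    using assms(1,2) unfolding bounded_on_def
    by (auto simp: complex_vector.scale_right_diff_distrib)
qed

lemma bounded_on_scaleR: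
  assumes "bounded_on S n f"
  shows "bounded_on S n (\<lambda>x. r *\<^sub>R f x)"
proof -
  obtain K where K: "\<And>x. x \<in> S \<Longrightarrow> norm (f x) \<le> K * n x"
    using assms unfolding bounded_on_def by blast
  have "norm (r *\<^sub>R f x) \<le> (\<bar>r\<bar> * K) * n x" if "x \<in> S" for x
    using mult_left_mono[OF K[OF that], of "\<bar>r\<bar>"] by (simp add: mult.assoc)
  then show ?thesis
    using assms unfolding bounded_on_def
    by (auto simp: scaleC_add_right scaleR_scaleC complex_vector.scale_left_commute)
qed

text \<open>Boundedness of \<open>f\<close> keeps the real supremum from being a default value.\<close>

lemma quotient_le_onorm_on:
  assumes f: "bounded_on S n f" and n: "\<And>x. x \<in> S \<Longrightarrow> 0 \<le> n x" and x: "x \<in> S"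
  shows "norm (f x) / n x \<le> onorm_on S n f"
proof -
  obtain K where K: "0 \<le> K" "\<And>x. x \<in> S \<Longrightarrow> norm (f x) \<le> K * n x"
    using bounded_on_obtain_bound[OF f n] by blast
  have "norm (f y) / n y \<le> K" if "y \<in> S" for y
    using K(2)[OF that] n[OF that] K(1) by (cases "n y = 0") (auto simp: divide_le_eq)
  then have "bdd_above ((\<lambda>x. norm (f x) / n x) ` S)" by (auto intro!: bdd_aboveI2)
  then show ?thesis unfolding onorm_on_def by (rule cSUP_upper[OF x])
qed

lemma norm_le_onorm_on:
  assumes f: "bounded_on S n f" and n: "\<And>x. x \<in> S \<Longrightarrow> 0 \<le> n x" and x: "x \<in> S"
  shows "norm (f x) \<le> onorm_on S n f * n x"
proof (cases "n x = 0")
  case True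
  obtain K where "\<And>x. x \<in> S \<Longrightarrow> norm (f x) \<le> K * n x"
    using bounded_on_obtain_bound[OF f n] by blast
  then show ?thesis using True x by fastforce
next
  case False
  then show ?thesis
    using quotient_le_onorm_on[OF f n x] n[OF x] by (simp add: divide_le_eq)
qed

lemma onorm_on_nonneg:
  assumes "S \<noteq> {}" "bounded_on S n f" "\<And>x. x \<in> S \<Longrightarrow> 0 \<le> n x"
  shows "0 \<le> onorm_on S n f"
proof -
  obtain x where x: "x \<in> S" using assms(1) by blast
  have "0 \<le> norm (f x) / n x" using assms(3)[OF x] by simp
  then show ?thesis using quotient_le_onorm_on[OF assms(2,3) x] by linarith
qed

lemma onorm_on_le:
  assumes "S \<noteq> {}" "0 \<le> K" "\<And>x. x \<in> S \<Longrightarrow> 0 \<le> n x" "\<And>x. x \<in> S \<Longrightarrow> norm (f x) \<le> K * n x"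
  shows "onorm_on S n f \<le> K"
  unfolding onorm_on_def
proof (rule cSUP_least[OF assms(1)])
  show "norm (f x) / n x \<le> K" if "x \<in> S" for x
    using assms(2-4) that by (cases "n x = 0") (auto simp: divide_le_eq order_less_le)
qed

lemma has_vector_derivative_quotient:
  assumes "(f has_vector_derivative f') (at x)"
  shows "((\<lambda>t. norm ((f t - f x) /\<^sub>R (t - x) - f')) \<longlongrightarrow> 0) (at x)"
proof -
  have "((\<lambda>t. norm (f t - f x - (t - x) *\<^sub>R f') / norm (t - x)) \<longlongrightarrow> 0) (at x)"
    using assms unfolding has_vector_derivative_def has_derivative_iff_norm by simp
  moreover have "\<forall>\<^sub>F t in at x. norm (f t - f x - (t - x) *\<^sub>R f') / norm (t - x) =
      norm ((f t - f x) /\<^sub>R (t - x) - f')"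
    unfolding eventually_at_filter
  proof (intro always_eventually allI impI)
    fix t assume "t \<noteq> x"
    then have "(f t - f x) /\<^sub>R (t - x) - f' = (f t - f x - (t - x) *\<^sub>R f') /\<^sub>R (t - x)"
      by (simp add: scaleR_diff_right)
    then show "norm (f t - f x - (t - x) *\<^sub>R f') / norm (t - x) = norm ((f t - f x) /\<^sub>R (t - x) - f')"
      by (simp add: divide_inverse mult.commute)
  qed
  ultimately show ?thesis by (rule Lim_transform_eventually)
qed

lemma norm_diff_le_quotient:
  assumes "norm ((y - x) /\<^sub>R s - z) \<le> e" "s \<noteq> 0"
  shows "norm (y - x - s *\<^sub>R z) \<le> \<bar>s\<bar> * e"
proof -
  have "y - x - s *\<^sub>R z = s *\<^sub>R ((y - x) /\<^sub>R s - z)"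
    using assms(2) by (simp add: scaleR_diff_right)
  then show ?thesis using assms(1) by (simp add: mult_left_mono)
qed

lemma op_has_derivative_imp_continuous:
  assumes deriv: "op_has_derivative_at S n T T' t0" and S: "S \<noteq> {}"
    and n: "\<And>x. x \<in> S \<Longrightarrow> 0 \<le> n x" and T: "\<forall>\<^sub>F t in nhds t0. bounded_on S n (T t)"
  shows "op_continuous_at S n T t0"
proof -
  have T': "bounded_on S n T'" using deriv by (simp add: op_has_derivative_at_def)
  define \<eta> where "\<eta> t = onorm_on S n (\<lambda>x. (T t x - T t0 x) /\<^sub>R (t - t0) - T' x)" for t
  have \<eta>: "(\<eta> \<longlongrightarrow> 0) (at t0)" using deriv by (simp add: op_has_derivative_at_def \<eta>_def[abs_def])
  have Tt0: "bounded_on S n (T t0)" using T by (rule eventually_nhds_x_imp_x)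
  let ?o = "\<lambda>t. onorm_on S n (\<lambda>x. T t x - T t0 x)" and ?b = "\<lambda>t. \<bar>t - t0\<bar> * (\<eta> t + onorm_on S n T')"
  have bounds: "0 \<le> ?o t \<and> ?o t \<le> ?b t" if t: "bounded_on S n (T t)" "t \<noteq> t0" for t
  proof -
    have diff: "bounded_on S n (\<lambda>x. T t x - T t0 x)" by (rule bounded_on_diff_fun[OF t(1) Tt0 n])
    have quot: "bounded_on S n (\<lambda>x. (T t x - T t0 x) /\<^sub>R (t - t0) - T' x)"
      by (rule bounded_on_diff_fun[OF bounded_on_scaleR[OF diff] T' n])
    have "norm (T t x - T t0 x) \<le> ?b t * n x" if "x \<in> S" for x
    proof -
      have "T t x - T t0 x = (t - t0) *\<^sub>R (((T t x - T t0 x) /\<^sub>R (t - t0) - T' x) + T' x)"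
        using t(2) by simp
      also have "norm \<dots> \<le> \<bar>t - t0\<bar> * (\<eta> t * n x + onorm_on S n T' * n x)"
        unfolding norm_scaleR real_norm_def \<eta>_def
        by (intro mult_left_mono norm_triangle_mono norm_le_onorm_on quot T' n that) auto
      finally show ?thesis by (simp add: algebra_simps)
    qed
    then have "?o t \<le> ?b t"
      using onorm_on_nonneg[OF S quot n] onorm_on_nonneg[OF S T' n]
      by (intro onorm_on_le S n) (auto simp: \<eta>_def)
    then show ?thesis using onorm_on_nonneg[OF S diff n] by blast
  qed
  have "\<forall>\<^sub>F t in at t0. 0 \<le> ?o t \<and> ?o t \<le> ?b t"
    using T bounds unfolding eventually_at_filter by (auto elim: eventually_mono)
  then have ev: "\<forall>\<^sub>F t in at t0. 0 \<le> ?o t" "\<forall>\<^sub>F t in at t0. ?o t \<le> ?b t"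
    by (auto elim: eventually_mono)
  have "(?b \<longlongrightarrow> \<bar>t0 - t0\<bar> * (0 + onorm_on S n T')) (at t0)"
    by (intro tendsto_intros \<eta>)
  then have "(?b \<longlongrightarrow> 0) (at t0)" by simp
  then show ?thesis
    unfolding op_continuous_at_def using tendsto_sandwich[OF ev tendsto_const] by blast
qed

lemma lipschitz_imp_isCont:
  assumes "lipschitz_at X t0" shows "isCont X t0"
proof -
  obtain K where K: "\<forall>\<^sub>F t in at t0. norm (X t - X t0) \<le> K * \<bar>t - t0\<bar>"
    using assms by (auto simp: lipschitz_at_def)
  have "((\<lambda>t. K * \<bar>t - t0\<bar>) \<longlongrightarrow> K * \<bar>t0 - t0\<bar>) (at t0)" by (intro tendsto_intros)
  then have "((\<lambda>t. X t - X t0) \<longlongrightarrow> 0) (at t0)"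
    using Lim_null_comparison[OF K] by simp
  then show ?thesis by (simp add: isCont_def LIM_zero_iff)
qed

lemma op_lipschitz_imp_continuous:
  assumes "op_lipschitz_at S n T t0" "\<forall>\<^sub>F t in at t0. 0 \<le> onorm_on S n (\<lambda>x. T t x - T t0 x)"
  shows "op_continuous_at S n T t0"
proof -
  obtain K where K: "\<forall>\<^sub>F t in at t0. onorm_on S n (\<lambda>x. T t x - T t0 x) \<le> K * \<bar>t - t0\<bar>"
    using assms(1) by (auto simp: op_lipschitz_at_def)
  have "((\<lambda>t. K * \<bar>t - t0\<bar>) \<longlongrightarrow> K * \<bar>t0 - t0\<bar>) (at t0)" by (intro tendsto_intros)
  then have "((\<lambda>t. K * \<bar>t - t0\<bar>) \<longlongrightarrow> 0) (at t0)" by simp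
  then show ?thesis
    unfolding op_continuous_at_def using tendsto_sandwich[OF assms(2) K tendsto_const] by blast
qed

lemma uniform_limit_ball:
  fixes f :: "real \<Rightarrow> complex \<Rightarrow> 'a::real_normed_vector"
  assumes "0 < \<epsilon>" "open I" "t0 \<in> I"
    and bound: "\<And>t \<zeta>. t \<in> I \<Longrightarrow> \<bar>t - t0\<bar> \<le> \<epsilon> \<Longrightarrow> t \<noteq> t0 \<Longrightarrow> cmod (\<zeta> - \<zeta>0) \<le> \<epsilon> \<Longrightarrow>
      norm (f t \<zeta> - g \<zeta>) \<le> b t"
    and b: "(b \<longlongrightarrow> 0) (at t0)"
  shows "uniform_limit (ball \<zeta>0 \<epsilon>) f g (at t0)"
proof (rule uniform_limitI)
  fix e :: real assume "0 < e"
  have "\<forall>\<^sub>F t in at t0. b t < e" using b \<open>0 < e\<close> by (rule order_tendstoD)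
  moreover have "\<forall>\<^sub>F t in at t0. t \<in> I" using assms(2,3) by (rule eventually_at_in_open')
  moreover have "\<forall>\<^sub>F t in at t0. \<bar>t - t0\<bar> < \<epsilon>"
    unfolding eventually_at dist_real_def using \<open>0 < \<epsilon>\<close> by blast
  moreover have "\<forall>\<^sub>F t in at t0. t \<noteq> t0" by (rule eventually_neq_at_within)
  ultimately show "\<forall>\<^sub>F t in at t0. \<forall>\<zeta>\<in>ball \<zeta>0 \<epsilon>. dist (f t \<zeta>) (g \<zeta>) < e"
  proof eventually_elim
    case (elim t)
    have "norm (f t \<zeta> - g \<zeta>) \<le> b t" if "\<zeta> \<in> ball \<zeta>0 \<epsilon>" for \<zeta>
      using that elim by (intro bound) (auto simp: dist_norm norm_minus_commute)
    then show ?case using elim(1) by (fastforce simp: dist_norm)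
  qed
qed


section \<open>Continuity and differentiability of the resolvent\<close>

theorem theorem3p5:
  fixes A :: "('h::chilbert_space \<times> 'h) set"
    and tr :: "real \<Rightarrow> 'h \<Rightarrow> 'k::chilbert_space \<times> 'k"
    and T :: "real \<Rightarrow> 'h \<times> 'h \<Rightarrow> ('k \<times> 'k) \<times> ('k \<times> 'k)"
    and P Q :: "real \<Rightarrow> ('k \<times> 'k) \<Rightarrow>\<^sub>L ('k \<times> 'k)"
    and AA BB :: "real \<Rightarrow> ('h \<times> 'h) set"
    and N :: "real \<Rightarrow> (('h \<times> 'h) \<times> ('h \<times> 'h)) set"
    and F G :: "real \<Rightarrow> 'h \<Rightarrow>\<^sub>L 'h"
    and V :: "real \<Rightarrow> ('h \<times> 'h) \<Rightarrow>\<^sub>L ('h \<times> 'h)"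
    and Hp :: "'h set" and np :: "'h \<Rightarrow> real"
    and Hp2 :: "('h \<times> 'h) set" and np2 :: "'h \<times> 'h \<Rightarrow> real"
    and R :: "real \<Rightarrow> complex \<Rightarrow> ('h \<times> 'h) \<Rightarrow>\<^sub>L ('h \<times> 'h)"
    and t0 :: real and \<zeta>0 :: complex
    and U :: "real \<Rightarrow> (real \<times> complex) set"
  assumes sep_h: "separable_space (euclidean :: 'h topology)"
    and sep_k: "separable_space (euclidean :: 'k topology)"
    and A: "linear_operator A" "closed A" "densely_defined A" "symmetric_op A"
    and deficiency:
      "finite_dim (op_ker (op_shift (op_adjoint A) (- \<i>)))"
      "finite_dim (op_ker (op_shift (op_adjoint A) \<i>))"
      "complex_vector.dim (op_ker (op_shift (op_adjoint A) (- \<i>))) =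
       complex_vector.dim (op_ker (op_shift (op_adjoint A) \<i>))"
    and Hp_def: "Hp = Domain (op_adjoint A)" and np_def: "np = graph_norm (op_adjoint A)"
    and Hp2_def: "Hp2 = Hp \<times> Hp" and np2_def: "np2 = pair_norm np"
    and tr: "\<And>t. t \<in> {0..1} \<Longrightarrow> bounded_on Hp np (tr t)"
      "\<And>t. t \<in> {0..1} \<Longrightarrow> tr t ` Hp = UNIV"
      "\<And>t u v. t \<in> {0..1} \<Longrightarrow> u \<in> Hp \<Longrightarrow> v \<in> Hp \<Longrightarrow>
         cinner (op_apply (op_adjoint A) u) v - cinner u (op_apply (op_adjoint A) v) =
         cinner (snd (tr t u)) (fst (tr t v)) - cinner (fst (tr t u)) (snd (tr t v))"
    and T_def: "\<And>t. T t = map_prod (tr t) (tr t)"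
    and PQ: "\<And>t. t \<in> {0..1} \<Longrightarrow> orthogonal_projection (P t) \<and> lagrangian (range (P t))"
      "\<And>t. t \<in> {0..1} \<Longrightarrow> orthogonal_projection (Q t) \<and> lagrangian (range (Q t))"
    and AA: "\<And>t. t \<in> {0..1} \<Longrightarrow>
        selfadjoint_op (AA t) \<and> A \<subseteq> AA t \<and> tr t ` Domain (AA t) = range (P t)"
    and BB: "\<And>t. t \<in> {0..1} \<Longrightarrow>
        selfadjoint_op (BB t) \<and> A \<subseteq> BB t \<and> tr t ` Domain (BB t) = range (Q t)"
    and N_def: "\<And>t. N t = op_offdiag (op_uminus (BB t)) (AA t)"
    and FG: "\<And>t. t \<in> {0..1} \<Longrightarrow> bounded_selfadjoint (F t)"
      "\<And>t. t \<in> {0..1} \<Longrightarrow> bounded_selfadjoint (G t)"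
    and V_def: "\<And>t. V t = block_offdiag (- G t) (F t)"
    and R_def: "\<And>t \<zeta>. R t \<zeta> = resolvent (op_add_bounded (N t) (V t)) \<zeta>"
    and U_def: "\<And>\<epsilon>. U \<epsilon> = {(t, \<zeta>). t \<in> {0<..<1} \<and> \<bar>t - t0\<bar> \<le> \<epsilon> \<and> cmod (\<zeta> - \<zeta>0) \<le> \<epsilon>}"
    and t0: "t0 \<in> {0<..<1}"
    and common: "\<exists>z. \<forall>\<^sub>F t in nhds t0. z \<notin> spectrum (op_add_bounded (N t) (V t))"
    and \<zeta>0: "\<zeta>0 \<notin> spectrum (op_add_bounded (N t0) (V t0))"
  shows
    "(isCont V t0 \<and> op_continuous_at Hp2 np2 T t0 \<and> isCont Q t0 \<and> isCont P t0 \<longrightarrow>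
       (\<exists>\<epsilon>>0. (\<forall>(t, \<zeta>)\<in>U \<epsilon>. \<zeta> \<notin> spectrum (op_add_bounded (N t) (V t))) \<and>
          uniform_limit (ball \<zeta>0 \<epsilon>) R (R t0) (at t0)))
   \<and> (lipschitz_at V t0 \<and> op_lipschitz_at Hp2 np2 T t0 \<and> lipschitz_at Q t0 \<and> lipschitz_at P t0 \<longrightarrow>
       (\<exists>\<epsilon>>0. (\<forall>(t, \<zeta>)\<in>U \<epsilon>. \<zeta> \<notin> spectrum (op_add_bounded (N t) (V t))) \<and>
          uniform_limit (ball \<zeta>0 \<epsilon>) R (R t0) (at t0) \<and>
          (\<exists>c>0. \<forall>(t, \<zeta>)\<in>U \<epsilon>. norm (R t \<zeta> - R t0 \<zeta>) \<le> c * \<bar>t - t0\<bar>)))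
   \<and> (\<forall>V' T' Q' P'.
       (V has_vector_derivative V') (at t0) \<and> op_has_derivative_at Hp2 np2 T T' t0 \<and>
       (Q has_vector_derivative Q') (at t0) \<and> (P has_vector_derivative P') (at t0) \<longrightarrow>
       (\<exists>\<epsilon>>0. (\<forall>(t, \<zeta>)\<in>U \<epsilon>. \<zeta> \<notin> spectrum (op_add_bounded (N t) (V t))) \<and>
          uniform_limit (ball \<zeta>0 \<epsilon>)
            (\<lambda>t \<zeta>. (R t \<zeta> - R t0 \<zeta> - (t - t0) *\<^sub>R
               (- (R t0 \<zeta> o\<^sub>L V' o\<^sub>L R t0 \<zeta>)
                + (op_tau o\<^sub>L cadjoint (comp_blinfun (T t0) (R t0 (cnj \<zeta>))) o\<^sub>L
                     block_diag (P' o\<^sub>L op_J) (- (Q' o\<^sub>L op_J)) o\<^sub>L comp_blinfun (T t0) (R t0 \<zeta>))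
                + (op_tau o\<^sub>L cadjoint (comp_blinfun (T t0) (R t0 (cnj \<zeta>))) o\<^sub>L
                     op_JJ o\<^sub>L comp_blinfun T' (R t0 \<zeta>)))) /\<^sub>R (t - t0))
            (\<lambda>_. 0) (at t0)))"
proof -
  define L where "L = offdiag_max A"
  define PQ where "PQ t = block_diag (P t) (Q t)" for t
  have Hp2: "Hp2 = dom2 A" and np2: "np2 = graph_norm2 A"
    by (simp_all add: Hp2_def Hp_def np2_def np_def)
  have ext: "extension Hp2 L op_tau op_JJ np2 (T t) (PQ t) (N t) (V t)" if "t \<in> {0..1}" for t
    unfolding Hp2 np2 L_def T_def PQ_def N_def V_def
  proof (rule extension_offdiag[OF A(3)])
    show "bounded_on (Domain (op_adjoint A)) (graph_norm (op_adjoint A)) (tr t)"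
      using tr(1)[OF that] by (simp add: Hp_def np_def)
    show "cinner (op_apply (op_adjoint A) u) v - cinner u (op_apply (op_adjoint A) v) =
        cinner (snd (tr t u)) (fst (tr t v)) - cinner (fst (tr t u)) (snd (tr t v))"
      if "u \<in> Domain (op_adjoint A)" "v \<in> Domain (op_adjoint A)" for u v
      using tr(3)[OF \<open>t \<in> {0..1}\<close>, of u v] that by (simp add: Hp_def)
    show "bounded_selfadjoint (F t)" "bounded_selfadjoint (G t)"
      using FG[OF that] by auto
    show "orthogonal_projection (P t)" "lagrangian (range (P t))"
      "orthogonal_projection (Q t)" "lagrangian (range (Q t))"
      using PQ[OF that] by auto
    show "selfadjoint_op (AA t)" "A \<subseteq> AA t" "tr t ` Domain (AA t) = range (P t)"
      "selfadjoint_op (BB t)" "A \<subseteq> BB t" "tr t ` Domain (BB t) = range (Q t)"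
      using AA[OF that] BB[OF that] by simp_all
  qed
  have t01: "t0 \<in> {0..1}" using t0 by simp
  have Hp2_ne: "Hp2 \<noteq> {}"
    using complex_vector.subspace_0[OF subspace_Domain_op_adjoint] unfolding Hp2 by blast
  have np2_nonneg: "0 \<le> np2 x" for x by (simp add: np2 pair_norm_def)
  have T_bounded: "bounded_on Hp2 np2 (T t)" if "t \<in> {0..1}" for t
    by (rule extension.T_bounded[OF ext[OF that]])
  have T_diff: "bounded_on Hp2 np2 (\<lambda>x. T t x - T t0 x)" if "t \<in> {0..1}" for t
    by (rule bounded_on_diff_fun[OF T_bounded[OF that] T_bounded[OF t01] np2_nonneg])
  have in_I: "\<forall>\<^sub>F t in nhds t0. t \<in> {0<..<1}"
    using t0 by (intro eventually_nhds_in_open) auto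
  define d where "d t = norm (V t - V t0) + onorm_on Hp2 np2 (\<lambda>x. T t x - T t0 x)
    + norm (P t - P t0) + norm (Q t - Q t0)" for t
  have onorm_nonneg: "0 \<le> onorm_on Hp2 np2 (\<lambda>x. T t x - T t0 x)" if "t \<in> {0..1}" for t
    by (rule onorm_on_nonneg[OF Hp2_ne T_diff[OF that] np2_nonneg])
  have PQ_diff: "norm (PQ t - PQ t0) \<le> norm (P t - P t0) + norm (Q t - Q t0)" for t
    unfolding PQ_def block_diag_diff by (rule norm_block_diag_le)
  have family: "extension_family Hp2 L op_tau op_JJ np2 T PQ N V {0<..<1} t0 c d"
    if "0 \<le> c" "\<And>w. w \<in> Hp2 \<Longrightarrow> norm (T t0 w) \<le> c * np2 w" for c
  proof (intro extension_family.intro extension_family_axioms.intro)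
    show "boundary_space Hp2 L op_tau (op_JJ :: (('k \<times> 'k) \<times> ('k \<times> 'k)) \<Rightarrow>\<^sub>L _) np2"
      unfolding Hp2 np2 L_def by (rule boundary_space_offdiag_max[OF A(3)])
    fix t :: real assume t: "t \<in> {0<..<1}"
    then have t': "t \<in> {0..1}" by simp
    show "extension Hp2 L op_tau op_JJ np2 (T t) (PQ t) (N t) (V t)" by (rule ext[OF t'])
    show "0 \<le> d t" "norm (V t - V t0) \<le> d t" "norm (PQ t - PQ t0) \<le> d t"
      using onorm_nonneg[OF t'] PQ_diff[of t] norm_ge_zero[of "V t - V t0"]
        norm_ge_zero[of "P t - P t0"] norm_ge_zero[of "Q t - Q t0"]
      unfolding d_def by linarith+
    show "norm (T t w - T t0 w) \<le> d t * np2 w" if "w \<in> Hp2" for w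
      by (rule order_trans[OF norm_le_onorm_on[OF T_diff[OF t'] np2_nonneg that]])
         (auto intro!: mult_right_mono np2_nonneg simp: d_def)
  qed (use t0 that in auto)
  obtain c0 where c0: "0 \<le> c0" "\<And>w. w \<in> Hp2 \<Longrightarrow> norm (T t0 w) \<le> c0 * np2 w"
    using bounded_on_obtain_bound[OF T_bounded[OF t01] np2_nonneg] by blast
  have d_t0: "d t0 = 0"
    using Hp2_ne by (simp add: d_def onorm_on_def)
  have stable: "(d \<longlongrightarrow> 0) (at t0) \<and> (\<exists>\<epsilon> k. 0 < \<epsilon> \<and> 0 < k \<and>
      (\<forall>t \<zeta>. (t, \<zeta>) \<in> U \<epsilon> \<longrightarrow> d t \<le> 1 \<and> \<zeta> \<notin> spectrum (op_add_bounded (N t) (V t)) \<and>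
        norm (R t \<zeta>) \<le> k \<and> norm (R t \<zeta> - R t0 \<zeta>) \<le> k * d t) \<and>
      uniform_limit (ball \<zeta>0 \<epsilon>) R (R t0) (at t0))"
    if "isCont V t0" "op_continuous_at Hp2 np2 T t0" "isCont Q t0" "isCont P t0"
  proof -
    have d_lim: "(d \<longlongrightarrow> 0) (at t0)"
      unfolding d_def using that
      by (intro tendsto_add_zero) (auto simp: op_continuous_at_def isCont_def LIM_zero_iff tendsto_norm_zero)
    then have "(d \<longlongrightarrow> 0) (nhds t0)"
      using tendsto_at_iff_tendsto_nhds[of d t0] by (simp add: d_t0)
    moreover obtain z where "\<forall>\<^sub>F t in nhds t0. z \<notin> spectrum (op_add_bounded (N t) (V t))"
      using common by blast
    ultimately obtain \<epsilon> k where \<epsilon>: "0 < \<epsilon>" "0 < k" "\<And>t \<zeta>. t \<in> {0<..<1} \<Longrightarrow> \<bar>t - t0\<bar> \<le> \<epsilon> \<Longrightarrow>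
        cmod (\<zeta> - \<zeta>0) \<le> \<epsilon> \<Longrightarrow> d t \<le> 1 \<and> \<zeta> \<notin> spectrum (op_add_bounded (N t) (V t)) \<and>
        norm (R t \<zeta>) \<le> k \<and> norm (R t \<zeta> - R t0 \<zeta>) \<le> k * d t"
      using extension_family.resolvent_set_stable[OF family[OF c0] _ _ \<zeta>0, folded R_def] by blast
    have "uniform_limit (ball \<zeta>0 \<epsilon>) R (R t0) (at t0)"
      by (rule uniform_limit_ball[where b="\<lambda>t. k * d t" and I="{0<..<1}"])
         (use \<epsilon> t0 tendsto_mult_right_zero[OF d_lim] in auto)
    then show ?thesis using d_lim \<epsilon> unfolding U_def by blast
  qed
  show ?thesis
  proof (intro conjI impI allI)
    assume "isCont V t0 \<and> op_continuous_at Hp2 np2 T t0 \<and> isCont Q t0 \<and> isCont P t0"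
    then show "\<exists>\<epsilon>>0. (\<forall>(t, \<zeta>)\<in>U \<epsilon>. \<zeta> \<notin> spectrum (op_add_bounded (N t) (V t))) \<and>
        uniform_limit (ball \<zeta>0 \<epsilon>) R (R t0) (at t0)"
      using stable by (metis (no_types, lifting) case_prodI2)
  next
    assume lip: "lipschitz_at V t0 \<and> op_lipschitz_at Hp2 np2 T t0 \<and> lipschitz_at Q t0 \<and> lipschitz_at P t0"
    have "\<forall>\<^sub>F t in at t0. 0 \<le> onorm_on Hp2 np2 (\<lambda>x. T t x - T t0 x)"
      using in_I unfolding eventually_at_filter by (auto elim!: eventually_mono intro!: onorm_nonneg)
    then have cont: "isCont V t0" "op_continuous_at Hp2 np2 T t0" "isCont Q t0" "isCont P t0"
      using lip by (auto intro: lipschitz_imp_isCont op_lipschitz_imp_continuous)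
    obtain \<epsilon> k where \<epsilon>: "0 < \<epsilon>" "0 < k"
        "\<And>t \<zeta>. (t, \<zeta>) \<in> U \<epsilon> \<Longrightarrow> \<zeta> \<notin> spectrum (op_add_bounded (N t) (V t))"
        "\<And>t \<zeta>. (t, \<zeta>) \<in> U \<epsilon> \<Longrightarrow> norm (R t \<zeta> - R t0 \<zeta>) \<le> k * d t"
      and lim: "uniform_limit (ball \<zeta>0 \<epsilon>) R (R t0) (at t0)"
      using stable[OF cont] by blast
    obtain K1 K2 K3 K4 where "\<forall>\<^sub>F t in at t0. norm (V t - V t0) \<le> K1 * \<bar>t - t0\<bar>"
        "\<forall>\<^sub>F t in at t0. onorm_on Hp2 np2 (\<lambda>x. T t x - T t0 x) \<le> K2 * \<bar>t - t0\<bar>"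
        "\<forall>\<^sub>F t in at t0. norm (Q t - Q t0) \<le> K3 * \<bar>t - t0\<bar>"
        "\<forall>\<^sub>F t in at t0. norm (P t - P t0) \<le> K4 * \<bar>t - t0\<bar>"
      using lip unfolding lipschitz_at_def op_lipschitz_at_def by blast
    then have "\<forall>\<^sub>F t in at t0. d t \<le> (K1 + K2 + K3 + K4) * \<bar>t - t0\<bar>"
      by eventually_elim (simp add: d_def algebra_simps)
    then obtain \<delta> where \<delta>: "0 < \<delta>"
      "\<And>t. t \<noteq> t0 \<Longrightarrow> \<bar>t - t0\<bar> < \<delta> \<Longrightarrow> d t \<le> (K1 + K2 + K3 + K4) * \<bar>t - t0\<bar>"
      unfolding eventually_at dist_real_def by auto
    \<comment> \<open>The Lipschitz constants may be negative; the constant of the estimate has to be positive.\<close>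
    define K where "K = \<bar>K1 + K2 + K3 + K4\<bar> + 1"
    have d_le: "d t \<le> K * \<bar>t - t0\<bar>" if "\<bar>t - t0\<bar> < \<delta>" for t
    proof (cases "t = t0")
      case False
      have "(K1 + K2 + K3 + K4) * \<bar>t - t0\<bar> \<le> K * \<bar>t - t0\<bar>"
        by (rule mult_right_mono) (auto simp: K_def)
      then show ?thesis using \<delta>(2)[OF False that] by linarith
    qed (simp add: d_t0)
    define \<epsilon>' where "\<epsilon>' = min \<epsilon> (\<delta> / 2)"
    have \<epsilon>': "0 < \<epsilon>'" "\<epsilon>' \<le> \<epsilon>" "\<epsilon>' < \<delta>" using \<epsilon>(1) \<delta>(1) by (auto simp: \<epsilon>'_def)
    have U_mono: "U \<epsilon>' \<subseteq> U \<epsilon>" using \<epsilon>'(2) by (auto simp: U_def)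
    show "\<exists>\<epsilon>>0. (\<forall>(t, \<zeta>)\<in>U \<epsilon>. \<zeta> \<notin> spectrum (op_add_bounded (N t) (V t))) \<and>
        uniform_limit (ball \<zeta>0 \<epsilon>) R (R t0) (at t0) \<and>
        (\<exists>c>0. \<forall>(t, \<zeta>)\<in>U \<epsilon>. norm (R t \<zeta> - R t0 \<zeta>) \<le> c * \<bar>t - t0\<bar>)"
    proof (rule exI[of _ \<epsilon>'], intro conjI)
      show "0 < \<epsilon>'" by (rule \<epsilon>')
      show "\<forall>(t, \<zeta>)\<in>U \<epsilon>'. \<zeta> \<notin> spectrum (op_add_bounded (N t) (V t))"
        using \<epsilon>(3) U_mono by blast
      show "uniform_limit (ball \<zeta>0 \<epsilon>') R (R t0) (at t0)"
        by (rule uniform_limit_on_subset[OF lim]) (use \<epsilon>'(2) in auto)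
      have "\<forall>(t, \<zeta>)\<in>U \<epsilon>'. norm (R t \<zeta> - R t0 \<zeta>) \<le> k * K * \<bar>t - t0\<bar>"
      proof clarify
        fix t \<zeta> assume t: "(t, \<zeta>) \<in> U \<epsilon>'"
        then have "\<bar>t - t0\<bar> < \<delta>" using \<epsilon>'(3) by (auto simp: U_def)
        then have "k * d t \<le> k * (K * \<bar>t - t0\<bar>)" using \<epsilon>(2) by (intro mult_left_mono d_le) auto
        then show "norm (R t \<zeta> - R t0 \<zeta>) \<le> k * K * \<bar>t - t0\<bar>"
          using \<epsilon>(4)[of t \<zeta>] t U_mono by (auto simp: mult.assoc)
      qed
      moreover have "0 < k * K" using \<epsilon>(2) by (simp add: K_def)
      ultimately show "\<exists>c>0. \<forall>(t, \<zeta>)\<in>U \<epsilon>'. norm (R t \<zeta> - R t0 \<zeta>) \<le> c * \<bar>t - t0\<bar>"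
        by blast
    qed
  next
    fix V' T' Q' P'
    assume deriv: "(V has_vector_derivative V') (at t0) \<and> op_has_derivative_at Hp2 np2 T T' t0 \<and>
       (Q has_vector_derivative Q') (at t0) \<and> (P has_vector_derivative P') (at t0)"
    have T': "bounded_on Hp2 np2 T'" using deriv by (simp add: op_has_derivative_at_def)
    have "\<forall>\<^sub>F t in nhds t0. bounded_on Hp2 np2 (T t)"
      using in_I by eventually_elim (simp add: T_bounded)
    then have cont: "isCont V t0" "op_continuous_at Hp2 np2 T t0" "isCont Q t0" "isCont P t0"
      using deriv op_has_derivative_imp_continuous[OF _ Hp2_ne np2_nonneg]
      by (auto intro: has_vector_derivative_continuous)
    obtain \<epsilon> k where \<epsilon>: "0 < \<epsilon>" "0 < k"
        "\<And>t \<zeta>. (t, \<zeta>) \<in> U \<epsilon> \<Longrightarrow> d t \<le> 1 \<and> \<zeta> \<notin> spectrum (op_add_bounded (N t) (V t)) \<and>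
        norm (R t \<zeta>) \<le> k \<and> norm (R t \<zeta> - R t0 \<zeta>) \<le> k * d t"
      and d_lim: "(d \<longlongrightarrow> 0) (at t0)"
      using stable[OF cont] by blast
    obtain c1 where c1: "0 \<le> c1" "\<And>w. w \<in> Hp2 \<Longrightarrow> norm (T' w) \<le> c1 * np2 w"
      using bounded_on_obtain_bound[OF T' np2_nonneg] by blast
    \<comment> \<open>One constant that bounds the trace at \<open>t0\<close> and all derivatives.\<close>
    define c where "c = c0 + c1 + norm (block_diag P' Q') + norm V'"
    have c: "0 \<le> c" "c0 \<le> c" "c1 \<le> c" "norm (block_diag P' Q') \<le> c" "norm V' \<le> c"
      using c0(1) c1(1) by (simp_all add: c_def)
    have c_bounds: "norm (T t0 w) \<le> c * np2 w" "norm (T' w) \<le> c * np2 w" if "w \<in> Hp2" for w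
      using c0(2)[OF that] c1(2)[OF that] mult_right_mono[OF c(2) np2_nonneg]
        mult_right_mono[OF c(3) np2_nonneg] by (meson order_trans)+
    define \<eta>T where "\<eta>T t = onorm_on Hp2 np2 (\<lambda>x. (T t x - T t0 x) /\<^sub>R (t - t0) - T' x)" for t
    define \<eta>V where "\<eta>V t = norm ((V t - V t0) /\<^sub>R (t - t0) - V')" for t
    define \<eta>P where "\<eta>P t = norm ((P t - P t0) /\<^sub>R (t - t0) - P')" for t
    define \<eta>Q where "\<eta>Q t = norm ((Q t - Q t0) /\<^sub>R (t - t0) - Q')" for t
    define \<eta> where "\<eta> t = \<eta>V t + \<eta>T t + \<eta>P t + \<eta>Q t" for t
    have "(\<eta> \<longlongrightarrow> 0) (at t0)"
    proof -
      have "(\<eta>T \<longlongrightarrow> 0) (at t0)"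
        using deriv by (simp add: op_has_derivative_at_def \<eta>T_def[abs_def])
      moreover have "(\<eta>V \<longlongrightarrow> 0) (at t0)" "(\<eta>P \<longlongrightarrow> 0) (at t0)" "(\<eta>Q \<longlongrightarrow> 0) (at t0)"
        unfolding \<eta>V_def \<eta>P_def \<eta>Q_def using deriv by (auto intro: has_vector_derivative_quotient)
      ultimately show ?thesis unfolding \<eta>_def by (intro tendsto_add_zero)
    qed
    define C where "C = (c + 1) ^ 3 * ((norm (V t0) + (cmod \<zeta>0 + \<epsilon>) + 2) * (1 + k))\<^sup>2"
    have "0 \<le> C" using c(1) by (simp add: C_def)
    let ?expansion = "\<lambda>\<zeta>. - (R t0 \<zeta> o\<^sub>L V' o\<^sub>L R t0 \<zeta>)
      + (op_tau o\<^sub>L cadjoint (comp_blinfun (T t0) (R t0 (cnj \<zeta>))) o\<^sub>L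
           block_diag (P' o\<^sub>L op_J) (- (Q' o\<^sub>L op_J)) o\<^sub>L comp_blinfun (T t0) (R t0 \<zeta>))
      + (op_tau o\<^sub>L cadjoint (comp_blinfun (T t0) (R t0 (cnj \<zeta>))) o\<^sub>L
           op_JJ o\<^sub>L comp_blinfun T' (R t0 \<zeta>))"
    have block: "block_diag (P' o\<^sub>L op_J) (- (Q' o\<^sub>L op_J)) = block_diag P' Q' o\<^sub>L op_JJ"
      by (rule blinfun_eqI) (auto simp: blinfun.minus_left blinfun.minus_right simp del: op_J_apply)
    have remainder: "norm ((R t \<zeta> - R t0 \<zeta> - (t - t0) *\<^sub>R ?expansion \<zeta>) /\<^sub>R (t - t0) - 0)
        \<le> C * (\<eta> t + (k + 2) * d t)"
      if t: "t \<in> {0<..<1}" "\<bar>t - t0\<bar> \<le> \<epsilon>" "t \<noteq> t0" and \<zeta>: "cmod (\<zeta> - \<zeta>0) \<le> \<epsilon>" for t \<zeta>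
    proof -
      have t': "t \<in> {0..1}" using t(1) by simp
      have U: "(t, \<zeta>) \<in> U \<epsilon>" "(t0, \<zeta>) \<in> U \<epsilon>" using t t0 \<zeta> \<epsilon>(1) by (auto simp: U_def)
      note Rt = \<epsilon>(3)[OF U(1)] and R0 = \<epsilon>(3)[OF U(2)]
      have res: "is_resolvent (op_add_bounded (N t) (V t)) \<zeta> (R t \<zeta>)"
        "is_resolvent (op_add_bounded (N t0) (V t0)) \<zeta> (R t0 \<zeta>)"
        unfolding R_def using Rt R0 by (auto intro: is_resolvent_resolvent)
      have res_cnj: "is_resolvent (op_add_bounded (N t0) (V t0)) (cnj \<zeta>) (R t0 (cnj \<zeta>))"
        using extension.resolvent_cnj[OF ext[OF t01] res(2)] resolvent_eqI unfolding R_def by metis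
      have quot: "bounded_on Hp2 np2 (\<lambda>x. (T t x - T t0 x) /\<^sub>R (t - t0) - T' x)"
        by (rule bounded_on_diff_fun[OF bounded_on_scaleR[OF T_diff[OF t']] T' np2_nonneg])
      have nonneg: "0 \<le> \<eta>T t" "0 \<le> \<eta>V t" "0 \<le> \<eta>P t" "0 \<le> \<eta>Q t"
        using onorm_on_nonneg[OF Hp2_ne quot np2_nonneg] by (simp_all add: \<eta>T_def \<eta>V_def \<eta>P_def \<eta>Q_def)
      have s: "t - t0 \<noteq> 0" using t(3) by simp
      have e_V: "norm (V t - V t0 - (t - t0) *\<^sub>R V') \<le> \<bar>t - t0\<bar> * \<eta> t"
        using nonneg by (intro norm_diff_le_quotient s) (simp add: \<eta>_def \<eta>V_def)
      have e_T: "norm (T t w - T t0 w - (t - t0) *\<^sub>R T' w) \<le> \<bar>t - t0\<bar> * \<eta> t * np2 w" if "w \<in> Hp2" for w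
      proof -
        have "norm ((T t w - T t0 w) /\<^sub>R (t - t0) - T' w) \<le> \<eta>T t * np2 w"
          unfolding \<eta>T_def by (rule norm_le_onorm_on[OF quot np2_nonneg that])
        also have "\<dots> \<le> \<eta> t * np2 w"
          using nonneg by (intro mult_right_mono np2_nonneg) (simp add: \<eta>_def)
        finally show ?thesis using norm_diff_le_quotient[OF _ s] by (simp add: mult.assoc)
      qed
      have e_P: "norm (PQ t - PQ t0 - (t - t0) *\<^sub>R block_diag P' Q') \<le> \<bar>t - t0\<bar> * \<eta> t"
      proof (rule norm_diff_le_quotient[OF _ s])
        have "norm ((PQ t - PQ t0) /\<^sub>R (t - t0) - block_diag P' Q') \<le> \<eta>P t + \<eta>Q t"
          unfolding PQ_def block_diag_diff block_diag_scaleR \<eta>P_def \<eta>Q_def by (rule norm_block_diag_le)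
        then show "norm ((PQ t - PQ t0) /\<^sub>R (t - t0) - block_diag P' Q') \<le> \<eta> t"
          using nonneg by (simp add: \<eta>_def)
      qed
      have pair: "extension_pair Hp2 L op_tau op_JJ np2 (T t0) (PQ t0) (N t0) (V t0)
          (T t) (PQ t) (N t) (V t) c (d t)"
        by (rule extension_family.extension_pair_t0[OF family[OF c(1) c_bounds(1)] t(1)]) (use Rt in simp_all)
      let ?C\<zeta> = "(c + 1) ^ 3 * ((norm (V t0) + cmod \<zeta> + 2) * (1 + k))\<^sup>2"
      have "norm (R t \<zeta> - R t0 \<zeta> - (t - t0) *\<^sub>R ?expansion \<zeta>)
          \<le> ?C\<zeta> * (\<bar>t - t0\<bar> * \<eta> t + \<bar>t - t0\<bar> * (norm (R t \<zeta> - R t0 \<zeta>) + 2 * d t))"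
        unfolding block
        by (rule extension_pair.norm_resolvent_remainder_le[OF pair res(1) _ res(2) _ res_cnj T' c_bounds(2)
              c(4) c(5) _ e_V e_P e_T])
           (use Rt R0 nonneg in \<open>auto simp: \<eta>_def\<close>)
      also have "\<dots> \<le> C * (\<bar>t - t0\<bar> * (\<eta> t + (k + 2) * d t))"
      proof (rule mult_mono)
        have "cmod \<zeta> \<le> cmod \<zeta>0 + \<epsilon>" using norm_triangle_ineq2[of \<zeta> \<zeta>0] \<zeta> by linarith
        then show "?C\<zeta> \<le> C"
          unfolding C_def using c(1) \<epsilon>(2) by (intro mult_left_mono power_mono mult_right_mono) auto
        have "\<bar>t - t0\<bar> * (norm (R t \<zeta> - R t0 \<zeta>) + 2 * d t) \<le> \<bar>t - t0\<bar> * (k * d t + 2 * d t)"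
          using Rt by (intro mult_left_mono add_right_mono) auto
        then show "\<bar>t - t0\<bar> * \<eta> t + \<bar>t - t0\<bar> * (norm (R t \<zeta> - R t0 \<zeta>) + 2 * d t)
            \<le> \<bar>t - t0\<bar> * (\<eta> t + (k + 2) * d t)"
          by (simp add: algebra_simps)
        have "0 \<le> d t" using onorm_nonneg[OF t'] by (simp add: d_def)
        then show "0 \<le> \<bar>t - t0\<bar> * \<eta> t + \<bar>t - t0\<bar> * (norm (R t \<zeta> - R t0 \<zeta>) + 2 * d t)"
          using nonneg by (simp add: \<eta>_def)
      qed (fact \<open>0 \<le> C\<close>)
      finally have "norm (R t \<zeta> - R t0 \<zeta> - (t - t0) *\<^sub>R ?expansion \<zeta>) / \<bar>t - t0\<bar>
          \<le> C * (\<eta> t + (k + 2) * d t)"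
        using s by (simp add: divide_le_eq mult.assoc mult.commute mult.left_commute)
      then show ?thesis by (simp only: norm_scaleR diff_zero abs_inverse) (simp only: divide_inverse mult.commute)
    qed
    show "\<exists>\<epsilon>>0. (\<forall>(t, \<zeta>)\<in>U \<epsilon>. \<zeta> \<notin> spectrum (op_add_bounded (N t) (V t))) \<and>
        uniform_limit (ball \<zeta>0 \<epsilon>)
          (\<lambda>t \<zeta>. (R t \<zeta> - R t0 \<zeta> - (t - t0) *\<^sub>R ?expansion \<zeta>) /\<^sub>R (t - t0)) (\<lambda>_. 0) (at t0)"
    proof (rule exI[of _ \<epsilon>], intro conjI)
      have "((\<lambda>t. C * (\<eta> t + (k + 2) * d t)) \<longlongrightarrow> C * (0 + (k + 2) * 0)) (at t0)"
        by (intro tendsto_intros \<open>(\<eta> \<longlongrightarrow> 0) (at t0)\<close> d_lim)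
      then have lim: "((\<lambda>t. C * (\<eta> t + (k + 2) * d t)) \<longlongrightarrow> 0) (at t0)" by simp
      show "uniform_limit (ball \<zeta>0 \<epsilon>)
          (\<lambda>t \<zeta>. (R t \<zeta> - R t0 \<zeta> - (t - t0) *\<^sub>R ?expansion \<zeta>) /\<^sub>R (t - t0)) (\<lambda>_. 0) (at t0)"
        by (rule uniform_limit_ball[OF \<epsilon>(1) open_greaterThanLessThan t0 remainder lim])
    qed (use \<epsilon> in auto)
  qed
qed

end
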